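(* Let $\widetilde{\mathcal{W}}=\mathcal{W}\ltimes\widetilde{I}$. The space of central extensions of $\widetilde{\mathcal{W}}$ is given by $$HL^2(\widetilde{\mathcal{W}})\cong H^2(\widetilde{\mathcal{W}})=\mathbb{C}\overline{\Omega}_{\mathrm{Vir}}\oplus\mathbb{C}\overline{\Omega}_1\oplus\mathbb{C}\overline{\Omega}_2\oplus\mathbb{C}\overline{\Omega}_{\mathrm{Ab}},$$ where $\overline{\Omega}$ denotes the cohomology class of $\Omega$. Furthermore, $$\mathrm{Der}(\widetilde{\mathcal{W}})=\mathrm{Inn}(\widetilde{\mathcal{W}})\oplus\mathbb{C}\delta_1\oplus\mathbb{C}\delta_2\oplus\mathbb{C}d_{\mathrm{Ab}}.$$ Consequently, $\dim H^2(\widetilde{\mathcal{W}})=4$ and $\dim H^1(\widetilde{\mathcal{W}};\widetilde{\mathcal{W}})=3$. The cocycles and derivations are those given in the context.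
   Context: All vector spaces are over $\mathbb{C}$. $\mathcal{W}=\mathrm{Der}(\mathbb{C}[t,t^{-1}])=\mathbb{C}[t,t^{-1}]\partial$, $\partial=\frac{d}{dt}$, is the Witt algebra, with basis $L_n=t^{n+1}\partial$ and $[L_n,L_m]=(m-n)L_{n+m}$. $\widetilde{I}=\mathbb{C}[t,t^{-1}]/\mathbb{C}$ is the quotient of the natural $\mathcal{W}$-module $\mathbb{C}[t,t^{-1}]$ (action $f\partial\cdot g=fg'$) by the constants. It is isomorphic, via the de Rham differential $g\mapsto dg=g'\,dt$, to the module of exact 1-forms $\widetilde{J}=\mathrm{span}\{t^n\,dt\mid n\in\mathbb{Z}\setminus\{-1\}\}$ with action $f\partial\cdot(g\,dt)=(fg)'\,dt$. $\widetilde{\mathcal{W}}=\mathcal{W}\ltimes\widetilde{I}$ is the semi-direct sum with $\widetilde{I}$ an abelian ideal. $\mathrm{Res}(g\,dt)$ is the coefficient of $t^{-1}$ in $g$. 2-cocycles on $\widetilde{\mathcal{W}}$ (antisymmetric; only the components not identically zero are given; $f\in\mathbb{C}[t,t^{-1}]$ in $f\partial\in\mathcal{W}$ and the other arguments in $\widetilde{I}$): $$\Omega_{\mathrm{Vir}}(L_n,L_m)=\tfrac1{12}n(n^2-1)\delta_{n+m}^0\quad(\delta^0_k=1\text{ if }k=0,\text{ and }0\text{ otherwise}),$$ $$\Omega_1(f\partial,g)=\mathrm{Res}(g\,d(f')),\qquad\Omega_2(f\partial,g)=\mathrm{Res}(g\,d(t^{-1}f)),\qquad\Omega_{\mathrm{Ab}}(f,g)=\mathrm{Res}(f\,dg).$$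 Derivations: $\delta_1(f\partial)=d(f')$ and $\delta_2(f\partial)=d(t^{-1}f)$, which are derivations $\mathcal{W}\to\widetilde{J}\cong\widetilde{I}$, regarded as derivations of $\widetilde{\mathcal{W}}$ by setting them to be zero on $\widetilde{I}$; and $d_{\mathrm{Ab}}(f\partial)=0$, $d_{\mathrm{Ab}}|_{\widetilde{I}}=\mathrm{id}_{\widetilde{I}}$. $H^2(\mathfrak{g})$ is Lie algebra cohomology with trivial coefficients $\mathbb{C}$; $\mathrm{Der}$, $\mathrm{Inn}$ are derivations and inner derivations, and $H^1(\mathfrak{g};\mathfrak{g})\cong\mathrm{Der}(\mathfrak{g})/\mathrm{Inn}(\mathfrak{g})$. $HL^2(\mathfrak{g})$ is the space of Leibniz 2-cocycles, i.e. bilinear $\alpha:\mathfrak{g}\times\mathfrak{g}\to\mathbb{C}$ with $\alpha([x,y],z)=\alpha(x,[y,z])+\alpha([x,z],y)$, modulo the maps $(x,y)\mapsto f([x,y])$, $f\in\mathfrak{g}^*$. There is a natural injection $H^2(\mathfrak{g})\hookrightarrow HL^2(\mathfrak{g})$. *)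

theory Defs
  imports
    Complex_Main
    "HOL-Library.Poly_Mapping"
    "HOL-Library.Function_Algebras"
    "HOL-Library.Product_Plus"
begin

section \<open>Linear algebra\<close>

text \<open>
  Functions carry the pointwise group structure of \<^theory>\<open>HOL-Library.Function_Algebras\<close>;
  the corresponding scalar multiplication is the following.
\<close>

definition fun_scale :: "('k \<Rightarrow> 'b \<Rightarrow> 'b) \<Rightarrow> 'k \<Rightarrow> ('a \<Rightarrow> 'b) \<Rightarrow> ('a \<Rightarrow> 'b)"
  where "fun_scale s c f = (\<lambda>x. s c (f x))"

lemma vector_space_fun_scale: "vector_space s \<Longrightarrow> vector_space (fun_scale s)"
  by (simp add: vector_space_def fun_scale_def plus_fun_def fun_eq_iff)

lemma vector_space_complex: "vector_space ((*) :: complex \<Rightarrow> complex \<Rightarrow> complex)"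
  by unfold_locales (simp_all add: algebra_simps)

text \<open>
  \<open>V\<close> is the internal direct sum of the subspaces in the list \<open>Us\<close>: the addition map from the
  external direct sum (the set of lists \<open>[u\<^sub>1, \<dots>, u\<^sub>r]\<close> with \<open>u\<^sub>i\<close> in the \<open>i\<close>-th
  subspace) to \<open>V\<close> is bijective.
\<close>

definition (in vector_space) direct_sum :: "'b set \<Rightarrow> 'b set list \<Rightarrow> bool"
  where "direct_sum V Us \<longleftrightarrow>
    (\<forall>U\<in>set Us. subspace U) \<and> bij_betw sum_list (listset Us) V"


text \<open>
  The relation defining the quotient \<open>Z / B\<close>; a partial equivalence relation with domain \<open>Z\<close>.
\<close>

definition quot_rel :: "'v::ab_group_add set \<Rightarrow> 'v set \<Rightarrow> 'v \<Rightarrow> 'v \<Rightarrow> bool"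
  where "quot_rel Z B u v \<longleftrightarrow> u \<in> Z \<and> v \<in> Z \<and> u - v \<in> B"

context vector_space
begin

lemma quot_rel_part_equivp:
  assumes "subspace Z" "subspace B"
  shows "part_equivp (quot_rel Z B)"
proof (rule part_equivpI)
  show "\<exists>x. quot_rel Z B x x"
    using assms by (auto simp: quot_rel_def subspace_0 intro!: exI[of _ 0])
  show "symp (quot_rel Z B)"
  proof (rule sympI)
    fix u v assume "quot_rel Z B u v"
    then show "quot_rel Z B v u"
      using subspace_neg[OF assms(2), of "u - v"] by (simp add: quot_rel_def)
  qed
  show "transp (quot_rel Z B)"
  proof (rule transpI)
    fix u v w assume "quot_rel Z B u v" "quot_rel Z B v w"
    then show "quot_rel Z B u w"
      using subspace_add[OF assms(2), of "u - v" "v - w"] by (simp add: quot_rel_def)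
  qed
qed

lemma quot_rel_0: "subspace Z \<Longrightarrow> subspace B \<Longrightarrow> quot_rel Z B 0 0"
  by (simp add: quot_rel_def subspace_0)

lemma quot_rel_add:
  "subspace Z \<Longrightarrow> subspace B \<Longrightarrow> quot_rel Z B u v \<Longrightarrow> quot_rel Z B u' v' \<Longrightarrow>
    quot_rel Z B (u + u') (v + v')"
  using subspace_add[of B "u - v" "u' - v'"]
  by (auto simp: quot_rel_def subspace_add add_diff_add)

lemma quot_rel_uminus:
  "subspace Z \<Longrightarrow> subspace B \<Longrightarrow> quot_rel Z B u v \<Longrightarrow> quot_rel Z B (- u) (- v)"
  using subspace_neg[of B "u - v"]
  by (auto simp: quot_rel_def subspace_neg)

lemma quot_rel_diff:
  "subspace Z \<Longrightarrow> subspace B \<Longrightarrow> quot_rel Z B u v \<Longrightarrow> quot_rel Z B u' v' \<Longrightarrow>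
    quot_rel Z B (u - u') (v - v')"
  using quot_rel_add[of Z B u v "- u'" "- v'"] quot_rel_uminus[of Z B u' v'] by simp

lemma quot_rel_scale:
  "subspace Z \<Longrightarrow> subspace B \<Longrightarrow> quot_rel Z B u v \<Longrightarrow> quot_rel Z B (c *s u) (c *s v)"
  using subspace_scale[of B "u - v" c]
  by (auto simp: quot_rel_def subspace_scale scale_right_diff_distrib)

end


section \<open>Lie algebras and their cohomology in low degrees\<close>

locale lie_algebra = vector_space scale
  for scale :: "complex \<Rightarrow> 'g::ab_group_add \<Rightarrow> 'g" +
  fixes bracket :: "'g \<Rightarrow> 'g \<Rightarrow> 'g"
  assumes linear_bracket_right: "Vector_Spaces.linear scale scale (bracket x)"
    and linear_bracket_left: "Vector_Spaces.linear scale scale (\<lambda>x. bracket x y)"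
    and bracket_self: "bracket x x = 0"
    and jacobi: "bracket x (bracket y z) + bracket y (bracket z x) + bracket z (bracket x y) = 0"
begin

definition Der :: "('g \<Rightarrow> 'g) set"
  where "Der = {D. Vector_Spaces.linear scale scale D \<and>
    (\<forall>x y. D (bracket x y) = bracket (D x) y + bracket x (D y))}"

definition Inn :: "('g \<Rightarrow> 'g) set"
  where "Inn = range bracket"

text \<open>
  Chevalley--Eilenberg complex in degrees 0, 1, 2, with coefficients in a module with scalar
  multiplication \<open>sM\<close> and action \<open>act\<close>.
\<close>

definition cochains1 :: "(complex \<Rightarrow> 'm::ab_group_add \<Rightarrow> 'm) \<Rightarrow> ('g \<Rightarrow> 'm) set"
  where "cochains1 sM = {c. Vector_Spaces.linear scale sM c}"

definition cochains2 :: "(complex \<Rightarrow> 'm::ab_group_add \<Rightarrow> 'm) \<Rightarrow> ('g \<Rightarrow> 'g \<Rightarrow> 'm) set"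
  where "cochains2 sM = {a. (\<forall>x. Vector_Spaces.linear scale sM (a x)) \<and>
    (\<forall>y. Vector_Spaces.linear scale sM (\<lambda>x. a x y)) \<and> (\<forall>x. a x x = 0)}"

definition d0 :: "('g \<Rightarrow> 'm \<Rightarrow> 'm::ab_group_add) \<Rightarrow> 'm \<Rightarrow> ('g \<Rightarrow> 'm)"
  where "d0 act m = (\<lambda>x. act x m)"

definition d1 :: "('g \<Rightarrow> 'm \<Rightarrow> 'm::ab_group_add) \<Rightarrow> ('g \<Rightarrow> 'm) \<Rightarrow> ('g \<Rightarrow> 'g \<Rightarrow> 'm)"
  where "d1 act c = (\<lambda>x y. act x (c y) - act y (c x) - c (bracket x y))"

definition d2 :: "('g \<Rightarrow> 'm \<Rightarrow> 'm::ab_group_add) \<Rightarrow> ('g \<Rightarrow> 'g \<Rightarrow> 'm) \<Rightarrow> ('g \<Rightarrow> 'g \<Rightarrow> 'g \<Rightarrow> 'm)"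
  where "d2 act a = (\<lambda>x y z. act x (a y z) - act y (a x z) + act z (a x y)
    - a (bracket x y) z + a (bracket x z) y - a (bracket y z) x)"

definition cocycles1 ::
  "(complex \<Rightarrow> 'm::ab_group_add \<Rightarrow> 'm) \<Rightarrow> ('g \<Rightarrow> 'm \<Rightarrow> 'm) \<Rightarrow> ('g \<Rightarrow> 'm) set"
  where "cocycles1 sM act = {c \<in> cochains1 sM. d1 act c = 0}"

definition coboundaries1 :: "('g \<Rightarrow> 'm \<Rightarrow> 'm::ab_group_add) \<Rightarrow> ('g \<Rightarrow> 'm) set"
  where "coboundaries1 act = range (d0 act)"

definition cocycles2 ::
  "(complex \<Rightarrow> 'm::ab_group_add \<Rightarrow> 'm) \<Rightarrow> ('g \<Rightarrow> 'm \<Rightarrow> 'm) \<Rightarrow> ('g \<Rightarrow> 'g \<Rightarrow> 'm) set"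
  where "cocycles2 sM act = {a \<in> cochains2 sM. d2 act a = 0}"

definition coboundaries2 ::
  "(complex \<Rightarrow> 'm::ab_group_add \<Rightarrow> 'm) \<Rightarrow> ('g \<Rightarrow> 'm \<Rightarrow> 'm) \<Rightarrow> ('g \<Rightarrow> 'g \<Rightarrow> 'm) set"
  where "coboundaries2 sM act = d1 act ` cochains1 sM"

text \<open>The trivial coefficients \<open>\<complex>\<close>: every element acts as 0.\<close>

definition Z2 :: "('g \<Rightarrow> 'g \<Rightarrow> complex) set"
  where "Z2 = cocycles2 (*) (\<lambda>_ _. 0)"

definition B2 :: "('g \<Rightarrow> 'g \<Rightarrow> complex) set"
  where "B2 = coboundaries2 (*) (\<lambda>_ _. 0)"

text \<open>The adjoint module.\<close>

definition Z1_ad :: "('g \<Rightarrow> 'g) set"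
  where "Z1_ad = cocycles1 scale bracket"

definition B1_ad :: "('g \<Rightarrow> 'g) set"
  where "B1_ad = coboundaries1 bracket"

text \<open>Leibniz 2-cocycles and 2-coboundaries with values in \<open>\<complex>\<close>.\<close>

definition ZL2 :: "('g \<Rightarrow> 'g \<Rightarrow> complex) set"
  where "ZL2 = {a. (\<forall>x. Vector_Spaces.linear scale (*) (a x)) \<and>
    (\<forall>y. Vector_Spaces.linear scale (*) (\<lambda>x. a x y)) \<and>
    (\<forall>x y z. a (bracket x y) z = a x (bracket y z) + a (bracket x z) y)}"

definition BL2 :: "('g \<Rightarrow> 'g \<Rightarrow> complex) set"
  where "BL2 = {\<lambda>x y. f (bracket x y) | f. Vector_Spaces.linear scale (*) f}"

lemma bracket_add_right: "bracket x (y + z) = bracket x y + bracket x z"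
  using linear_bracket_right[of x] by (simp add: Vector_Spaces.linear_iff)

lemma bracket_scale_right: "bracket x (scale c y) = scale c (bracket x y)"
  using linear_bracket_right[of x] by (simp add: Vector_Spaces.linear_iff)

lemma linear_fun_0: "vector_space sM \<Longrightarrow> Vector_Spaces.linear scale sM (\<lambda>_. 0)"
  unfolding Vector_Spaces.linear_iff
  by (simp add: vector_space_axioms module.scale_zero_right[OF module_iff_vector_space[THEN iffD2]])

lemma linear_fun_add:
  "Vector_Spaces.linear scale sM f \<Longrightarrow> Vector_Spaces.linear scale sM g \<Longrightarrow>
    Vector_Spaces.linear scale sM (\<lambda>x. f x + g x)"
  unfolding Vector_Spaces.linear_iff
  by (auto simp: module.scale_right_distrib[OF module_iff_vector_space[THEN iffD2]])

lemma linear_fun_scale: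
  "Vector_Spaces.linear scale sM f \<Longrightarrow> Vector_Spaces.linear scale sM (\<lambda>x. sM c (f x))"
  unfolding Vector_Spaces.linear_iff
  by (auto simp: module.scale_right_distrib[OF module_iff_vector_space[THEN iffD2]]
      module.scale_scale[OF module_iff_vector_space[THEN iffD2]] mult.commute)

lemma bracket_zero_right: "bracket x 0 = 0"
  using bracket_scale_right[of x 0 0] by simp

lemma B2_eq_BL2: "B2 = BL2"
proof
  show "B2 \<subseteq> BL2"
  proof
    fix a assume "a \<in> B2"
    then obtain c where c: "Vector_Spaces.linear scale (*) c" "a = d1 (\<lambda>_ _. 0) c"
      by (auto simp: B2_def coboundaries2_def cochains1_def)
    have "Vector_Spaces.linear scale (*) (\<lambda>x. (-1) * c x)"
      using linear_fun_scale[OF c(1), of "-1"] .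
    moreover have "a = (\<lambda>x y. (-1) * c (bracket x y))"
      by (simp add: c(2) d1_def)
    ultimately show "a \<in> BL2"
      unfolding BL2_def by (intro CollectI exI[of _ "\<lambda>x. (-1) * c x"] conjI)
  qed
  show "BL2 \<subseteq> B2"
  proof
    fix a assume "a \<in> BL2"
    then obtain c where c: "Vector_Spaces.linear scale (*) c" "a = (\<lambda>x y. c (bracket x y))"
      by (auto simp: BL2_def)
    have "Vector_Spaces.linear scale (*) (\<lambda>x. (-1) * c x)"
      using linear_fun_scale[OF c(1), of "-1"] .
    moreover have "a = d1 (\<lambda>_ _. 0) (\<lambda>x. (-1) * c x)"
      by (simp add: c(2) d1_def)
    ultimately show "a \<in> B2"
      unfolding B2_def coboundaries2_def cochains1_def by (intro image_eqI CollectI)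
  qed
qed

end

text \<open>The space of all maps \<open>\<gg> \<times> \<gg> \<rightarrow> \<complex>\<close>, in which the cocycle spaces live.\<close>

abbreviation form_scale :: "complex \<Rightarrow> ('g \<Rightarrow> 'g \<Rightarrow> complex) \<Rightarrow> ('g \<Rightarrow> 'g \<Rightarrow> complex)"
  where "form_scale \<equiv> fun_scale (fun_scale (*))"

interpretation form: vector_space form_scale
  by (intro vector_space_fun_scale vector_space_complex)

context lie_algebra
begin

lemma linear_form_0: "Vector_Spaces.linear scale (*) (\<lambda>_. 0 :: complex)"
  by (rule linear_fun_0) (rule vector_space_complex)

lemma Z2_iff: "a \<in> Z2 \<longleftrightarrow> (\<forall>x. Vector_Spaces.linear scale (*) (a x)) \<and>
    (\<forall>y. Vector_Spaces.linear scale (*) (\<lambda>x. a x y)) \<and> (\<forall>x. a x x = 0) \<and>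
    (\<forall>x y z. - a (bracket x y) z + a (bracket x z) y - a (bracket y z) x = 0)"
proof -
  have "d2 (\<lambda>_ _. 0) a = 0 \<longleftrightarrow>
      (\<forall>x y z. - a (bracket x y) z + a (bracket x z) y - a (bracket y z) x = 0)"
    by (simp only: d2_def fun_eq_iff zero_fun_def diff_0 add_0_left diff_zero add_0_right)
  then show ?thesis
    unfolding Z2_def cocycles2_def cochains2_def by blast
qed

lemma subspace_Z2: "form.subspace Z2"
  unfolding form.subspace_def
proof (intro conjI ballI allI)
  show "0 \<in> Z2"
    by (simp add: Z2_iff zero_fun_def linear_form_0)
next
  fix a b assume ab: "a \<in> Z2" "b \<in> Z2"
  show "a + b \<in> Z2"
    unfolding Z2_iff plus_fun_def
  proof (intro conjI allI)
    fix x y z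
    show "Vector_Spaces.linear scale (*) (\<lambda>y. a x y + b x y)"
      using ab linear_fun_add[of "(*)" "a x" "b x"] unfolding Z2_iff by blast
    show "Vector_Spaces.linear scale (*) (\<lambda>x. a x y + b x y)"
      using ab linear_fun_add[of "(*)" "\<lambda>x. a x y" "\<lambda>x. b x y"] unfolding Z2_iff by blast
    have "a x x = 0" "b x x = 0"
      using ab unfolding Z2_iff by blast+
    then show "a x x + b x x = 0" by simp
    have "- a (bracket x y) z + a (bracket x z) y - a (bracket y z) x = 0"
      "- b (bracket x y) z + b (bracket x z) y - b (bracket y z) x = 0"
      using ab unfolding Z2_iff by blast+
    then show "- (a (bracket x y) z + b (bracket x y) z) + (a (bracket x z) y + b (bracket x z) y)
        - (a (bracket y z) x + b (bracket y z) x) = 0"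
      by algebra
  qed
next
  fix c a assume a: "a \<in> Z2"
  show "form_scale c a \<in> Z2"
    unfolding Z2_iff fun_scale_def
  proof (intro conjI allI)
    fix x y z
    show "Vector_Spaces.linear scale (*) (\<lambda>y. c * a x y)"
      using a linear_fun_scale[of "(*)" "a x" c] unfolding Z2_iff by blast
    show "Vector_Spaces.linear scale (*) (\<lambda>x. c * a x y)"
      using a linear_fun_scale[of "(*)" "\<lambda>x. a x y" c] unfolding Z2_iff by blast
    have "a x x = 0"
      using a unfolding Z2_iff by blast
    then show "c * a x x = 0" by simp
    have "- a (bracket x y) z + a (bracket x z) y - a (bracket y z) x = 0"
      using a unfolding Z2_iff by blast
    then show "- (c * a (bracket x y) z) + c * a (bracket x z) y - c * a (bracket y z) x = 0"
      by algebra
  qed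
qed

lemma ZL2_iff: "a \<in> ZL2 \<longleftrightarrow> (\<forall>x. Vector_Spaces.linear scale (*) (a x)) \<and>
    (\<forall>y. Vector_Spaces.linear scale (*) (\<lambda>x. a x y)) \<and>
    (\<forall>x y z. a (bracket x y) z = a x (bracket y z) + a (bracket x z) y)"
  unfolding ZL2_def by blast

lemma subspace_ZL2: "form.subspace ZL2"
  unfolding form.subspace_def
proof (intro conjI ballI allI)
  show "0 \<in> ZL2"
    by (simp add: ZL2_iff zero_fun_def linear_form_0)
next
  fix a b assume ab: "a \<in> ZL2" "b \<in> ZL2"
  show "a + b \<in> ZL2"
    unfolding ZL2_iff plus_fun_def
  proof (intro conjI allI)
    fix x y z
    show "Vector_Spaces.linear scale (*) (\<lambda>y. a x y + b x y)"
      using ab linear_fun_add[of "(*)" "a x" "b x"] unfolding ZL2_iff by blast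
    show "Vector_Spaces.linear scale (*) (\<lambda>x. a x y + b x y)"
      using ab linear_fun_add[of "(*)" "\<lambda>x. a x y" "\<lambda>x. b x y"] unfolding ZL2_iff by blast
    have "a (bracket x y) z = a x (bracket y z) + a (bracket x z) y"
      "b (bracket x y) z = b x (bracket y z) + b (bracket x z) y"
      using ab unfolding ZL2_iff by blast+
    then show "a (bracket x y) z + b (bracket x y) z =
        a x (bracket y z) + b x (bracket y z) + (a (bracket x z) y + b (bracket x z) y)"
      by algebra
  qed
next
  fix c a assume a: "a \<in> ZL2"
  show "form_scale c a \<in> ZL2"
    unfolding ZL2_iff fun_scale_def
  proof (intro conjI allI)
    fix x y z
    show "Vector_Spaces.linear scale (*) (\<lambda>y. c * a x y)"
      using a linear_fun_scale[of "(*)" "a x" c] unfolding ZL2_iff by blast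
    show "Vector_Spaces.linear scale (*) (\<lambda>x. c * a x y)"
      using a linear_fun_scale[of "(*)" "\<lambda>x. a x y" c] unfolding ZL2_iff by blast
    have "a (bracket x y) z = a x (bracket y z) + a (bracket x z) y"
      using a unfolding ZL2_iff by blast
    then show "c * a (bracket x y) z = c * a x (bracket y z) + c * a (bracket x z) y"
      by algebra
  qed
qed

lemma Z2_subset_ZL2: "Z2 \<subseteq> ZL2"
proof
  fix a assume a: "a \<in> Z2"
  have anti: "a x y = - a y x" for x y
  proof -
    have 1: "Vector_Spaces.linear scale (*) (a u)" "Vector_Spaces.linear scale (*) (\<lambda>x. a x u)"
      and alt: "a u u = 0" for u
      using a unfolding Z2_iff by blast+
    have "a (x + y) (x + y) = a (x + y) x + a (x + y) y"
      using 1(1)[of "x + y"] unfolding Vector_Spaces.linear_iff by blast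
    moreover have "a (x + y) x = a x x + a y x" "a (x + y) y = a x y + a y y"
      using 1(2) unfolding Vector_Spaces.linear_iff by blast+
    ultimately show ?thesis by (simp add: alt eq_neg_iff_add_eq_0 add.commute)
  qed
  have "a (bracket x y) z = a x (bracket y z) + a (bracket x z) y" for x y z
  proof -
    have "- a (bracket x y) z + a (bracket x z) y - a (bracket y z) x = 0"
      using a unfolding Z2_iff by blast
    with anti[of x "bracket y z"] show ?thesis by algebra
  qed
  with a show "a \<in> ZL2" unfolding Z2_iff ZL2_iff by blast
qed

lemma subspace_BL2: "form.subspace BL2"
  unfolding form.subspace_def
proof (intro conjI ballI allI)
  show "0 \<in> BL2"
    unfolding BL2_def using linear_fun_0[OF vector_space_complex] by (auto simp: fun_eq_iff)
next
  fix a b assume "a \<in> BL2" "b \<in> BL2"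
  then obtain f g where "Vector_Spaces.linear scale (*) f" "a = (\<lambda>x y. f (bracket x y))"
    "Vector_Spaces.linear scale (*) g" "b = (\<lambda>x y. g (bracket x y))"
    by (auto simp: BL2_def)
  then show "a + b \<in> BL2"
    unfolding BL2_def using linear_fun_add[of "(*)" f g]
    by (auto simp: fun_eq_iff intro!: exI[of _ "\<lambda>x. f x + g x"])
next
  fix c a assume "a \<in> BL2"
  then obtain f where "Vector_Spaces.linear scale (*) f" "a = (\<lambda>x y. f (bracket x y))"
    by (auto simp: BL2_def)
  then show "form_scale c a \<in> BL2"
    unfolding BL2_def using linear_fun_scale[of "(*)" f c]
    by (auto simp: fun_eq_iff fun_scale_def intro!: exI[of _ "\<lambda>x. c * f x"])
qed

lemma subspace_B2: "form.subspace B2"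
  by (simp add: B2_eq_BL2 subspace_BL2)

lemma vector_space_endo: "vector_space (fun_scale scale)"
  by (rule vector_space_fun_scale) (rule vector_space_axioms)

sublocale endo: vector_space "fun_scale scale :: complex \<Rightarrow> ('g \<Rightarrow> 'g) \<Rightarrow> _"
  by (rule vector_space_endo)

lemma subspace_Z1_ad: "endo.subspace Z1_ad"
proof -
  have *: "Z1_ad = {c. Vector_Spaces.linear scale scale c \<and>
      (\<forall>x y. c (bracket x y) = bracket x (c y) - bracket y (c x))}"
    by (auto simp: Z1_ad_def cocycles1_def cochains1_def d1_def fun_eq_iff)
  show ?thesis
    unfolding endo.subspace_def *
    by (auto simp: fun_scale_def plus_fun_def zero_fun_def linear_fun_0 vector_space_axioms
        linear_fun_add linear_fun_scale bracket_add_right bracket_scale_right bracket_zero_right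
        scale_right_diff_distrib)
qed

lemma subspace_B1_ad: "endo.subspace B1_ad"
  unfolding endo.subspace_def B1_ad_def coboundaries1_def d0_def
  by (auto simp: fun_scale_def fun_eq_iff image_iff bracket_zero_right intro: exI[of _ "0 :: 'g"]
      simp flip: bracket_add_right bracket_scale_right)

end


section \<open>Laurent polynomials and the Lie algebra\<close>

text \<open>
  \<open>\<complex>[t, t\<^sup>-\<^sup>1]\<close> is the monoid algebra of \<open>(\<int>, +)\<close>: \<open>Poly_Mapping.lookup f n\<close> is the
  coefficient of \<open>t\<^sup>n\<close>, and the product is the convolution product.
\<close>

type_synonym laurent = "int \<Rightarrow>\<^sub>0 complex"

abbreviation tpow :: "int \<Rightarrow> laurent"
  where "tpow n \<equiv> Poly_Mapping.single n 1"

definition lscale :: "complex \<Rightarrow> laurent \<Rightarrow> laurent"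
  where "lscale c f = Poly_Mapping.single 0 c * f"

lift_definition lderiv :: "laurent \<Rightarrow> laurent"
  is "\<lambda>f n. of_int (n + 1) * f (n + 1)"
proof -
  fix f :: "int \<Rightarrow> complex" assume fin: "finite {n. f n \<noteq> 0}"
  have "{n. of_int (n + 1) * f (n + 1) \<noteq> 0} \<subseteq> (\<lambda>n. n - 1) ` {n. f n \<noteq> 0}"
    by (auto intro!: image_eqI[of _ _ "_ + 1"])
  with fin show "finite {n. of_int (n + 1) * f (n + 1) \<noteq> 0}"
    by (meson finite_imageI finite_subset)
qed

lemma lookup_single0_mult [simp]:
  "Poly_Mapping.lookup (Poly_Mapping.single 0 c * (f :: laurent)) n = c * Poly_Mapping.lookup f n"
  by (simp flip: mult_map_scale_conv_mult add: map.rep_eq when_def)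

lemma lookup_lscale [simp]: "Poly_Mapping.lookup (lscale c f) n = c * Poly_Mapping.lookup f n"
  by (simp add: lscale_def)

interpretation laurent: vector_space lscale
  by unfold_locales
    (auto intro!: poly_mapping_eqI simp: lookup_add algebra_simps)

lemma lookup_lderiv [simp]:
  "Poly_Mapping.lookup (lderiv f) n = of_int (n + 1) * Poly_Mapping.lookup f (n + 1)"
  by transfer simp

lemma lderiv_add [simp]: "lderiv (f + g) = lderiv f + lderiv g"
  by (rule poly_mapping_eqI) (simp add: lookup_add algebra_simps)

lemma lderiv_diff [simp]: "lderiv (f - g) = lderiv f - lderiv g"
  by (rule poly_mapping_eqI) (simp add: lookup_minus algebra_simps)

lemma lderiv_zero [simp]: "lderiv 0 = 0"
  by (rule poly_mapping_eqI) simp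

lemma lderiv_const [simp]: "lderiv (Poly_Mapping.single 0 c) = 0"
  by (rule poly_mapping_eqI) (auto simp: lookup_single when_def eq_neg_iff_add_eq_0[symmetric])

lemma lderiv_single:
  "lderiv (Poly_Mapping.single n c) = Poly_Mapping.single (n - 1) (of_int n * c)"
  by (rule poly_mapping_eqI) (auto simp: lookup_single when_def)

lemma laurent_induct [case_names zero add]:
  assumes "P 0" "\<And>n c f. P f \<Longrightarrow> P (Poly_Mapping.single n c + f)"
  shows "P (f :: laurent)"
proof (induction f rule: update_induct)
  case const
  show ?case using assms(1) by simp
next
  case (update f a b)
  have "Poly_Mapping.update a b f = Poly_Mapping.single a b + f"
    using update(1)
    by (intro poly_mapping_eqI) (auto simp: lookup_update lookup_add lookup_single when_def in_keys_iff)
  with update assms(2) show ?case by simp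
qed

lemma lderiv_mult [simp]: "lderiv (f * g) = f * lderiv g + lderiv f * g"
proof (induction f rule: laurent_induct)
  case (add n c f)
  have "lderiv (Poly_Mapping.single n c * g) =
      Poly_Mapping.single n c * lderiv g + lderiv (Poly_Mapping.single n c) * g"
  proof (induction g rule: laurent_induct)
    case (add m d g)
    have "lderiv (Poly_Mapping.single n c * Poly_Mapping.single m d) =
      Poly_Mapping.single n c * lderiv (Poly_Mapping.single m d)
      + lderiv (Poly_Mapping.single n c) * Poly_Mapping.single m d"
      by (simp add: mult_single lderiv_single algebra_simps flip: single_add)
    with add show ?case by (simp add: algebra_simps)
  qed simp
  with add show ?case by (simp add: algebra_simps)
qed simp

lemma lderiv_lscale [simp]: "lderiv (lscale c f) = lscale c (lderiv f)"
  by (simp add: lscale_def)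

lemma lderiv_eq_0_iff: "lderiv f = 0 \<longleftrightarrow> (\<exists>c. f = Poly_Mapping.single 0 c)"
proof
  assume *: "lderiv f = 0"
  have "Poly_Mapping.lookup f n = 0" if "n \<noteq> 0" for n
    using arg_cong[OF *, of "\<lambda>g. Poly_Mapping.lookup g (n - 1)"] that by simp
  then show "\<exists>c. f = Poly_Mapping.single 0 c"
    by (intro exI[of _ "Poly_Mapping.lookup f 0"] poly_mapping_eqI)
      (auto simp: lookup_single when_def)
qed auto

text \<open>
  A 1-form \<open>g dt\<close> is represented by its coefficient \<open>g\<close>, so the de Rham differential of Laurent
  polynomials is \<^const>\<open>lderiv\<close>. The residue of \<open>g dt\<close>:
\<close>

definition res :: "laurent \<Rightarrow> complex"
  where "res g = Poly_Mapping.lookup g (-1)"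

lemma res_lderiv [simp]: "res (lderiv f) = 0"
  by (simp add: res_def)

lemma res_add: "res (f + g) = res f + res g"
  by (simp add: res_def lookup_add)

lemma res_diff: "res (f - g) = res f - res g"
  by (simp add: res_def lookup_minus)

lemma res_single0_mult [simp]: "res (Poly_Mapping.single 0 c * f) = c * res f"
  by (simp add: res_def)

definition eq_mod_const :: "laurent \<Rightarrow> laurent \<Rightarrow> bool"
  where "eq_mod_const f g \<longleftrightarrow> (\<exists>c. f - g = Poly_Mapping.single 0 c)"

lemma eq_mod_const_iff: "eq_mod_const f g \<longleftrightarrow> lderiv f = lderiv g"
  using lderiv_eq_0_iff[of "f - g"] by (simp add: eq_mod_const_def)

quotient_type itilde = laurent / eq_mod_const
  morphisms itilde_rep itilde_class
  by (rule equivpI) (auto intro!: reflpI sympI transpI simp: eq_mod_const_iff)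

lemma lderiv_uminus [simp]: "lderiv (- f) = - lderiv f"
  using lderiv_diff[of 0 f] by simp

instantiation itilde :: ab_group_add
begin

lift_definition zero_itilde :: itilde is 0 .
lift_definition plus_itilde :: "itilde \<Rightarrow> itilde \<Rightarrow> itilde" is "(+)"
  by (simp add: eq_mod_const_iff)
lift_definition minus_itilde :: "itilde \<Rightarrow> itilde \<Rightarrow> itilde" is "(-)"
  by (simp add: eq_mod_const_iff)
lift_definition uminus_itilde :: "itilde \<Rightarrow> itilde" is uminus
  by (simp add: eq_mod_const_iff)

instance
  by standard (transfer; simp add: eq_mod_const_iff add_ac)+

end

lift_definition iscale :: "complex \<Rightarrow> itilde \<Rightarrow> itilde" is lscale
  by (simp add: eq_mod_const_iff)

interpretation itilde: vector_space iscale
  by unfold_locales (transfer; simp add: eq_mod_const_iff laurent.scale_right_distrib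
      laurent.scale_left_distrib)+

text \<open>The differential \<open>g \<mapsto> dg\<close>, which identifies \<open>\<complex>[t, t\<^sup>-\<^sup>1] / \<complex>\<close> with the exact 1-forms.\<close>

lift_definition derham :: "itilde \<Rightarrow> laurent" is lderiv
  by (simp add: eq_mod_const_iff)

lemma derham_class [simp]: "derham (itilde_class f) = lderiv f"
  by transfer simp

lemma inj_derham: "inj derham"
  by (rule injI, transfer) (simp add: eq_mod_const_iff)

text \<open>
  The vector field \<open>f\<partial>\<close> is represented by \<open>f\<close>: its action on \<open>\<complex>[t, t\<^sup>-\<^sup>1] / \<complex>\<close>, and the bracket
  \<open>[f\<partial>, g\<partial>] = (f g' - g f')\<partial>\<close> of vector fields.
\<close>

lift_definition vf_act :: "laurent \<Rightarrow> itilde \<Rightarrow> itilde" is "\<lambda>f g. f * lderiv g"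
  by (simp add: eq_mod_const_iff)

definition witt_bracket :: "laurent \<Rightarrow> laurent \<Rightarrow> laurent"
  where "witt_bracket f g = f * lderiv g - g * lderiv f"

definition witt_L :: "int \<Rightarrow> laurent"
  where "witt_L n = tpow (n + 1)"

lemma witt_bracket_L: "witt_bracket (witt_L n) (witt_L m) = lscale (of_int (m - n)) (witt_L (n + m))"
  by (simp add: witt_bracket_def witt_L_def lscale_def lderiv_single mult_single algebra_simps
      flip: single_diff)

text \<open>The pair \<open>(f, a)\<close> stands for \<open>f\<partial> + a\<close> in the semidirect sum.\<close>

type_synonym wtilde = "laurent \<times> itilde"

definition wscale :: "complex \<Rightarrow> wtilde \<Rightarrow> wtilde"
  where "wscale c x = (lscale c (fst x), iscale c (snd x))"

definition wbracket :: "wtilde \<Rightarrow> wtilde \<Rightarrow> wtilde"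
  where "wbracket x y =
    (witt_bracket (fst x) (fst y), vf_act (fst x) (snd y) - vf_act (fst y) (snd x))"

lemma derham_simps [simp]:
  "derham (a + b) = derham a + derham b" "derham (a - b) = derham a - derham b"
  "derham (iscale c a) = lscale c (derham a)" "derham (vf_act f a) = lderiv (f * derham a)"
  "derham 0 = 0"
  by (transfer; simp)+

lemma itilde_eqI: "derham a = derham b \<Longrightarrow> a = b"
  using inj_derham by (simp add: inj_eq)

lemma vector_space_wscale: "vector_space wscale"
  by unfold_locales
    (auto simp: wscale_def laurent.scale_right_distrib laurent.scale_left_distrib
      itilde.scale_right_distrib itilde.scale_left_distrib)

interpretation wt: lie_algebra wscale wbracket
proof (intro lie_algebra.intro lie_algebra_axioms.intro vector_space_wscale)
  show "Vector_Spaces.linear wscale wscale (wbracket x)" for x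
    unfolding Vector_Spaces.linear_iff
    by (auto simp: vector_space_wscale wbracket_def wscale_def witt_bracket_def prod_eq_iff lscale_def
        algebra_simps intro!: itilde_eqI)
  show "Vector_Spaces.linear wscale wscale (\<lambda>x. wbracket x y)" for y
    unfolding Vector_Spaces.linear_iff
    by (auto simp: vector_space_wscale wbracket_def wscale_def witt_bracket_def prod_eq_iff lscale_def
        algebra_simps intro!: itilde_eqI)
  show "wbracket x x = 0" for x
    by (simp add: wbracket_def witt_bracket_def prod_eq_iff)
  show "wbracket x (wbracket y z) + wbracket y (wbracket z x) + wbracket z (wbracket x y) = 0"
    for x y z
    by (auto simp: wbracket_def witt_bracket_def prod_eq_iff algebra_simps intro!: itilde_eqI)
qed


section \<open>The cocycles and derivations\<close>

definition vir_coeff :: "int \<Rightarrow> int \<Rightarrow> complex"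
  where "vir_coeff n m = (if n + m = 0 then of_int (n * (n\<^sup>2 - 1)) / 12 else 0)"

text \<open>
  Bilinear extension from the basis \<open>L\<^sub>n = t\<^sup>n\<^sup>+\<^sup>1\<partial>\<close>; \<open>L\<^sub>n\<close> occurs in \<open>f\<partial>\<close> with the coefficient of \<open>t\<^sup>n\<^sup>+\<^sup>1\<close>
  in \<open>f\<close>.
\<close>

definition Omega_Vir :: "wtilde \<Rightarrow> wtilde \<Rightarrow> complex"
  where "Omega_Vir x y =
    (\<Sum>i\<in>Poly_Mapping.keys (fst x). \<Sum>j\<in>Poly_Mapping.keys (fst y).
      Poly_Mapping.lookup (fst x) i * Poly_Mapping.lookup (fst y) j * vir_coeff (i - 1) (j - 1))"

lemma Omega_Vir_L: "Omega_Vir (witt_L n, a) (witt_L m, b) = vir_coeff n m"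
  by (simp add: Omega_Vir_def witt_L_def)

lift_definition omega1 :: "laurent \<Rightarrow> itilde \<Rightarrow> complex"
  is "\<lambda>f g. res (g * lderiv (lderiv f))"
proof -
  fix f g h :: laurent assume "eq_mod_const g h"
  then obtain c where "g = h + Poly_Mapping.single 0 c"
    by (auto simp: eq_mod_const_def diff_eq_eq add.commute)
  then show "res (g * lderiv (lderiv f)) = res (h * lderiv (lderiv f))"
    by (simp only: distrib_right res_add res_single0_mult res_lderiv) simp
qed

lift_definition omega2 :: "laurent \<Rightarrow> itilde \<Rightarrow> complex"
  is "\<lambda>f g. res (g * lderiv (tpow (-1) * f))"
proof -
  fix f g h :: laurent assume "eq_mod_const g h"
  then obtain c where "g = h + Poly_Mapping.single 0 c"
    by (auto simp: eq_mod_const_def diff_eq_eq add.commute)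
  then show "res (g * lderiv (tpow (-1) * f)) = res (h * lderiv (tpow (-1) * f))"
    by (simp only: distrib_right res_add res_single0_mult res_lderiv) simp
qed

lift_definition omegaAb :: "itilde \<Rightarrow> itilde \<Rightarrow> complex"
  is "\<lambda>f g. res (f * lderiv g)"
proof -
  fix f f' g g' :: laurent
  assume "eq_mod_const f f'" and "eq_mod_const g g'"
  then obtain c where "f = f' + Poly_Mapping.single 0 c" "lderiv g = lderiv g'"
    by (metis diff_eq_eq add.commute eq_mod_const_def eq_mod_const_iff)
  then show "res (f * lderiv g) = res (f' * lderiv g')"
    by (simp only: distrib_right res_add res_single0_mult res_lderiv) simp
qed

definition Omega_1 :: "wtilde \<Rightarrow> wtilde \<Rightarrow> complex"
  where "Omega_1 x y = omega1 (fst x) (snd y) - omega1 (fst y) (snd x)"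

definition Omega_2 :: "wtilde \<Rightarrow> wtilde \<Rightarrow> complex"
  where "Omega_2 x y = omega2 (fst x) (snd y) - omega2 (fst y) (snd x)"

definition Omega_Ab :: "wtilde \<Rightarrow> wtilde \<Rightarrow> complex"
  where "Omega_Ab x y = omegaAb (snd x) (snd y)"

text \<open>
  \<open>\<delta>\<^sub>1\<close> and \<open>\<delta>\<^sub>2\<close> take values in exact 1-forms, which are pulled back along the isomorphism
  \<^const>\<open>derham\<close>.
\<close>

definition delta1 :: "wtilde \<Rightarrow> wtilde"
  where "delta1 x = (0, inv derham (lderiv (lderiv (fst x))))"

definition delta2 :: "wtilde \<Rightarrow> wtilde"
  where "delta2 x = (0, inv derham (lderiv (tpow (-1) * fst x)))"

definition d_Ab :: "wtilde \<Rightarrow> wtilde"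
  where "d_Ab x = (0, snd x)"

lemma delta1_eq: "delta1 x = (0, itilde_class (lderiv (fst x)))"
  unfolding delta1_def by (metis derham_class inj_derham inv_f_f)

lemma delta2_eq: "delta2 x = (0, itilde_class (tpow (-1) * fst x))"
  unfolding delta2_def by (metis derham_class inj_derham inv_f_f)


section \<open>The cohomology spaces\<close>

text \<open>
  The quotients are partial: \<open>H2_class a\<close> and its analogues are meaningful only for cocycles \<open>a\<close>.
\<close>

quotient_type H2 = "wtilde \<Rightarrow> wtilde \<Rightarrow> complex" / partial: "quot_rel wt.Z2 wt.B2"
  morphisms H2_rep H2_class
  by (rule form.quot_rel_part_equivp) (rule wt.subspace_Z2 wt.subspace_B2)+

instantiation H2 :: ab_group_add
begin

lift_definition zero_H2 :: H2 is 0
  by (rule form.quot_rel_0) (rule wt.subspace_Z2 wt.subspace_B2)+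
lift_definition plus_H2 :: "H2 \<Rightarrow> H2 \<Rightarrow> H2" is "(+)"
  by (rule form.quot_rel_add) (rule wt.subspace_Z2 wt.subspace_B2 | assumption)+
lift_definition minus_H2 :: "H2 \<Rightarrow> H2 \<Rightarrow> H2" is "(-)"
  by (rule form.quot_rel_diff) (rule wt.subspace_Z2 wt.subspace_B2 | assumption)+
lift_definition uminus_H2 :: "H2 \<Rightarrow> H2" is uminus
  by (rule form.quot_rel_uminus) (rule wt.subspace_Z2 wt.subspace_B2 | assumption)+

instance
  by standard
    (transfer; simp add: quot_rel_def algebra_simps form.subspace_0 form.subspace_add
      form.subspace_neg form.subspace_diff wt.subspace_Z2 wt.subspace_B2)+

end

lift_definition H2_scale :: "complex \<Rightarrow> H2 \<Rightarrow> H2" is "form_scale"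
  by (rule form.quot_rel_scale) (rule wt.subspace_Z2 wt.subspace_B2 | assumption)+

interpretation H2: vector_space H2_scale
  by unfold_locales
    (transfer; simp add: quot_rel_def form.scale_right_distrib form.scale_left_distrib
      form.subspace_0 form.subspace_add form.subspace_scale wt.subspace_Z2 wt.subspace_B2)+

quotient_type HL2 = "wtilde \<Rightarrow> wtilde \<Rightarrow> complex" / partial: "quot_rel wt.ZL2 wt.BL2"
  morphisms HL2_rep HL2_class
  by (rule form.quot_rel_part_equivp) (rule wt.subspace_ZL2 wt.subspace_BL2)+

instantiation HL2 :: ab_group_add
begin

lift_definition zero_HL2 :: HL2 is 0
  by (rule form.quot_rel_0) (rule wt.subspace_ZL2 wt.subspace_BL2)+
lift_definition plus_HL2 :: "HL2 \<Rightarrow> HL2 \<Rightarrow> HL2" is "(+)"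
  by (rule form.quot_rel_add) (rule wt.subspace_ZL2 wt.subspace_BL2 | assumption)+
lift_definition minus_HL2 :: "HL2 \<Rightarrow> HL2 \<Rightarrow> HL2" is "(-)"
  by (rule form.quot_rel_diff) (rule wt.subspace_ZL2 wt.subspace_BL2 | assumption)+
lift_definition uminus_HL2 :: "HL2 \<Rightarrow> HL2" is uminus
  by (rule form.quot_rel_uminus) (rule wt.subspace_ZL2 wt.subspace_BL2 | assumption)+

instance
  by standard
    (transfer; simp add: quot_rel_def algebra_simps form.subspace_0 form.subspace_add
      form.subspace_neg form.subspace_diff wt.subspace_ZL2 wt.subspace_BL2)+

end

lift_definition HL2_scale :: "complex \<Rightarrow> HL2 \<Rightarrow> HL2" is "form_scale"
  by (rule form.quot_rel_scale) (rule wt.subspace_ZL2 wt.subspace_BL2 | assumption)+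

interpretation HL2: vector_space HL2_scale
  by unfold_locales
    (transfer; simp add: quot_rel_def form.scale_right_distrib form.scale_left_distrib
      form.subspace_0 form.subspace_add form.subspace_scale wt.subspace_ZL2 wt.subspace_BL2)+

text \<open>\<open>H\<^sup>1\<close> with coefficients in the adjoint module.\<close>

quotient_type H1ad = "wtilde \<Rightarrow> wtilde" / partial: "quot_rel wt.Z1_ad wt.B1_ad"
  morphisms H1ad_rep H1ad_class
  by (rule wt.endo.quot_rel_part_equivp) (rule wt.subspace_Z1_ad wt.subspace_B1_ad)+

instantiation H1ad :: ab_group_add
begin

lift_definition zero_H1ad :: H1ad is 0
  by (rule wt.endo.quot_rel_0) (rule wt.subspace_Z1_ad wt.subspace_B1_ad)+
lift_definition plus_H1ad :: "H1ad \<Rightarrow> H1ad \<Rightarrow> H1ad" is "(+)"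
  by (rule wt.endo.quot_rel_add) (rule wt.subspace_Z1_ad wt.subspace_B1_ad | assumption)+
lift_definition minus_H1ad :: "H1ad \<Rightarrow> H1ad \<Rightarrow> H1ad" is "(-)"
  by (rule wt.endo.quot_rel_diff) (rule wt.subspace_Z1_ad wt.subspace_B1_ad | assumption)+
lift_definition uminus_H1ad :: "H1ad \<Rightarrow> H1ad" is uminus
  by (rule wt.endo.quot_rel_uminus) (rule wt.subspace_Z1_ad wt.subspace_B1_ad | assumption)+

instance
  by standard
    (transfer; simp add: quot_rel_def algebra_simps wt.endo.subspace_0 wt.endo.subspace_add
      wt.endo.subspace_neg wt.endo.subspace_diff wt.subspace_Z1_ad wt.subspace_B1_ad)+

end

lift_definition H1ad_scale :: "complex \<Rightarrow> H1ad \<Rightarrow> H1ad" is "fun_scale wscale"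
  by (rule wt.endo.quot_rel_scale) (rule wt.subspace_Z1_ad wt.subspace_B1_ad | assumption)+

interpretation H1ad: vector_space H1ad_scale
  by unfold_locales
    (transfer; simp add: quot_rel_def wt.endo.scale_right_distrib wt.endo.scale_left_distrib
      wt.endo.subspace_0 wt.endo.subspace_add wt.endo.subspace_scale wt.subspace_Z1_ad wt.subspace_B1_ad)+

text \<open>The natural map, induced by the inclusion of the alternating cocycles in the Leibniz cocycles.\<close>

lift_definition H2_to_HL2 :: "H2 \<Rightarrow> HL2" is "\<lambda>a. a"
  using wt.Z2_subset_ZL2 by (auto simp: quot_rel_def wt.B2_eq_BL2)

end

theory Submission
  imports Defs
begin

text \<open>
  The algebra has the homogeneous basis \<open>L\<^sub>n\<close> (\<open>n \<in> \<int>\<close>) and \<open>I\<^sub>m = t\<^sup>m\<close> (\<open>m \<noteq> 0\<close>), with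
  \<open>[L\<^sub>n, L\<^sub>m] = (m - n) L\<^bsub>n+m\<^esub>\<close>, \<open>[L\<^sub>n, I\<^sub>m] = m I\<^bsub>n+m\<^esub>\<close> and \<open>[I\<^sub>n, I\<^sub>m] = 0\<close>. Everything rests on one feature:
  \<open>ad L\<^sub>0\<close> multiplies a homogeneous element by its degree, and since \<open>I\<^sub>0 = 0\<close> its kernel is the line
  \<open>\<complex> L\<^sub>0\<close>. So \<open>ad L\<^sub>0\<close> has an inverse up to multiples of \<open>L\<^sub>0\<close>, the linear map \<open>deg_inv\<close>.

  With this map a 2-cocycle \<open>a\<close> can be changed by a coboundary so that \<open>a(L\<^sub>0, \<cdot>) = 0\<close>. The cocycle
  identity with first argument \<open>L\<^sub>0\<close> then says that \<open>a(x, y) = 0\<close> unless the degrees of \<open>x\<close> and \<open>y\<close>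
  add up to \<open>0\<close>, and \<open>a\<close> is given by three sequences: its values on \<open>(L\<^sub>n, L\<^sub>-\<^sub>n)\<close>,
  \<open>(L\<^sub>n, I\<^sub>-\<^sub>n)\<close> and \<open>(I\<^sub>-\<^sub>n, I\<^sub>n)\<close>. The remaining cocycle identities are recursions, whose solution
  spaces have dimensions \<open>1\<close>, \<open>2\<close> and \<open>1\<close> once the value at \<open>(L\<^sub>1, L\<^sub>-\<^sub>1)\<close> has been removed by a
  coboundary; this is \<open>Z2_classify_normalized\<close>. Evaluation at a few pairs of basis vectors shows that
  no nontrivial combination of the four cocycles is a coboundary.

  A derivation can likewise be changed by an inner one so that it kills \<open>L\<^sub>0\<close>. It then preserves the
  degree, and the derivation property again reduces to recursions, solved in
  \<open>Der_classify_normalized\<close>. The same recursion governs the values \<open>L\<^sub>n \<mapsto> I\<^sub>n\<close> of a derivation and the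
  values of a cocycle at \<open>(L\<^sub>n, I\<^sub>-\<^sub>n)\<close>, because the pairing \<open>(f, g) \<mapsto> Res(f dg)\<close> identifies
  \<open>\<complex>[t, t\<^sup>-\<^sup>1] / \<complex>\<close> with its graded dual (\<open>crossed_coeffs_affine\<close>).

  For a Leibniz cocycle, the symmetrisation \<open>s\<close> satisfies \<open>s(x, [y, z]) = - s(y, [x, z])\<close>. With \<open>x = L\<^sub>0\<close>
  this expresses all of \<open>s\<close> by the number \<open>s(L\<^sub>0, L\<^sub>0)\<close>, and one further instance makes that number
  vanish. Hence Leibniz and Lie cocycles coincide (\<open>ZL2_subset_Z2\<close>), and so do the coboundaries.
\<close>

section \<open>Direct sums of subspaces\<close>

lemma listset_iff: "us \<in> listset Us \<longleftrightarrow> list_all2 (\<in>) us Us"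
  by (induction Us arbitrary: us) (auto simp: set_Cons_def list_all2_Cons2)

context vector_space
begin

text \<open>
  Addition is injective on the external direct sum as soon as its kernel is trivial, because lists
  of vectors can be subtracted entrywise.
\<close>

lemma direct_sumI:
  assumes sub: "\<And>U. U \<in> set Us \<Longrightarrow> subspace U"
    and img: "sum_list ` listset Us = V"
    and ker: "\<And>us. us \<in> listset Us \<Longrightarrow> sum_list us = 0 \<Longrightarrow> set us \<subseteq> {0}"
  shows "direct_sum V Us"
proof -
  have "inj_on sum_list (listset Us)"
  proof (rule inj_onI)
    fix us vs assume us: "us \<in> listset Us" and vs: "vs \<in> listset Us" and eq: "sum_list us = sum_list vs"
    let ?d = "map2 (-) us vs"
    have len: "length us = length vs"
      using us vs by (metis list_all2_lengthD listset_iff)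
    have "?d \<in> listset Us"
      unfolding listset_iff list_all2_conv_all_nth
    proof (intro conjI allI impI)
      show "length ?d = length Us"
        using us len by (simp add: listset_iff list_all2_lengthD)
    next
      fix i assume i: "i < length ?d"
      with len have "i < length us" "i < length vs" by auto
      then show "?d ! i \<in> Us ! i"
        using us vs by (simp add: listset_iff list_all2_conv_all_nth sub subspace_diff)
    qed
    moreover have "sum_list ?d = sum_list us - sum_list vs"
      using len by (induction us vs rule: list_induct2) (simp_all add: algebra_simps)
    ultimately have "set ?d \<subseteq> {0}"
      by (intro ker) (simp_all only: eq diff_self)
    with len show "us = vs"
      by (induction us vs rule: list_induct2) auto
  qed
  with sub img show ?thesis
    by (simp add: direct_sum_def bij_betw_def)
qed

lemma span_set_eq_sum_list:
  "span (set vs) = sum_list ` listset (map (\<lambda>v. span {v}) vs)"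
proof (induction vs)
  case (Cons v vs)
  have "span (insert v (set vs)) = {x + y | x y. x \<in> span {v} \<and> y \<in> span (set vs)}"
    using span_Un[of "{v}" "set vs"] by simp
  also have "\<dots> = sum_list ` set_Cons (span {v}) (listset (map (\<lambda>v. span {v}) vs))"
  proof safe
    fix x y assume "x \<in> span {v}" "y \<in> span (set vs)"
    then obtain us where "us \<in> listset (map (\<lambda>v. span {v}) vs)" "y = sum_list us"
      unfolding Cons by blast
    with \<open>x \<in> span {v}\<close> show "x + y \<in> sum_list ` set_Cons (span {v}) (listset (map (\<lambda>v. span {v}) vs))"
      by (intro image_eqI[of _ _ "x # us"]) (simp_all add: set_Cons_def)
  next
    fix us assume "us \<in> set_Cons (span {v}) (listset (map (\<lambda>v. span {v}) vs))"
    then obtain x ws where "us = x # ws" "x \<in> span {v}" "sum_list ws \<in> span (set vs)"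
      unfolding Cons set_Cons_def by blast
    then show "\<exists>x y. sum_list us = x + y \<and> x \<in> span {v} \<and> y \<in> span (set vs)"
      by auto
  qed
  finally show ?case by simp
qed simp

text \<open>Spanning lines in a direct sum are given by linearly independent vectors.\<close>

lemma independent_lines:
  assumes "\<And>us. us \<in> listset (map (\<lambda>v. span {v}) vs) \<Longrightarrow> sum_list us = 0 \<Longrightarrow> set us \<subseteq> {0}"
    and "0 \<notin> set vs"
  shows "independent (set vs) \<and> distinct vs"
  using assms
proof (induction vs)
  case (Cons v vs)
  have "set us \<subseteq> {0}" if "us \<in> listset (map (\<lambda>v. span {v}) vs)" "sum_list us = 0" for us
    using Cons.prems(1)[of "0 # us"] that by (auto simp: set_Cons_def span_zero)
  then have IH: "independent (set vs)" "distinct vs"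
    using Cons by auto
  have "v \<notin> span (set vs)"
  proof
    assume "v \<in> span (set vs)"
    then obtain us where "us \<in> listset (map (\<lambda>v. span {v}) vs)" "v = sum_list us"
      unfolding span_set_eq_sum_list by blast
    then have "set ((- v) # us) \<subseteq> {0}"
      using span_neg[OF span_base[of v "{v}"]] by (intro Cons.prems(1)) (simp_all add: set_Cons_def)
    with Cons.prems(2) show False by simp
  qed
  moreover from this have "v \<notin> set vs"
    using span_base by blast
  ultimately show ?case
    using IH by (simp add: independent_insert)
qed (simp add: independent_empty)

lemma dim_eq_length:
  assumes "direct_sum V (map (\<lambda>v. span {v}) vs)" and "0 \<notin> set vs"
  shows "dim V = length vs"
proof -
  let ?Us = "map (\<lambda>v. span {v}) vs"
  have inj: "inj_on sum_list (listset ?Us)" and img: "sum_list ` listset ?Us = V"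
    using assms(1) by (auto simp: direct_sum_def bij_betw_def)
  have zero: "replicate (length vs) 0 \<in> listset ?Us"
    by (simp add: listset_iff list_all2_conv_all_nth span_zero)
  have "set us \<subseteq> {0}" if "us \<in> listset ?Us" "sum_list us = 0" for us
  proof -
    have "sum_list (replicate n 0) = (0 :: 'b)" for n
      by (induction n) auto
    then have "us = replicate (length vs) 0"
      by (intro inj_onD[OF inj _ that(1) zero]) (simp add: that(2))
    then show ?thesis by auto
  qed
  then have "independent (set vs) \<and> distinct vs"
    using assms(2) by (rule independent_lines)
  then show ?thesis
    using img dim_span_eq_card_independent[of "set vs"]
    by (simp add: span_set_eq_sum_list distinct_card)
qed

lemma direct_sum_lines3:
  assumes "V = {a *s u + b *s v + c *s w | a b c. True}"
    and "\<And>a b c. a *s u + b *s v + c *s w = 0 \<Longrightarrow> a = 0 \<and> b = 0 \<and> c = 0"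
  shows "direct_sum V [span {u}, span {v}, span {w}]"
proof (rule direct_sumI)
  show "sum_list ` listset [span {u}, span {v}, span {w}] = V"
    unfolding assms(1)
  proof safe
    fix a b c
    have "[a *s u, b *s v, c *s w] \<in> listset [span {u}, span {v}, span {w}]"
      by (auto simp: listset_iff span_singleton simp del: listset.simps)
    then show "a *s u + b *s v + c *s w \<in> sum_list ` listset [span {u}, span {v}, span {w}]"
      by (rule rev_image_eqI) (simp add: add.assoc)
  qed (auto simp: set_Cons_def span_singleton add.assoc, blast)
next
  fix us assume us: "us \<in> listset [span {u}, span {v}, span {w}]" and 0: "sum_list us = 0"
  from us obtain a b c where "us = [a *s u, b *s v, c *s w]"
    by (auto simp: set_Cons_def span_singleton)
  with 0 assms(2)[of a b c] show "set us \<subseteq> {0}"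
    by (simp add: add.assoc)
qed auto

lemma direct_sum_subspace_lines3:
  assumes "subspace U"
    and "V = {y + a *s u + b *s v + c *s w | y a b c. y \<in> U}"
    and "\<And>y a b c. y \<in> U \<Longrightarrow> y + a *s u + b *s v + c *s w = 0 \<Longrightarrow> y = 0 \<and> a = 0 \<and> b = 0 \<and> c = 0"
  shows "direct_sum V [U, span {u}, span {v}, span {w}]"
proof (rule direct_sumI)
  show "sum_list ` listset [U, span {u}, span {v}, span {w}] = V"
    unfolding assms(2)
  proof safe
    fix y a b c assume "y \<in> U"
    then have "[y, a *s u, b *s v, c *s w] \<in> listset [U, span {u}, span {v}, span {w}]"
      by (auto simp: listset_iff span_singleton simp del: listset.simps)
    then show "y + a *s u + b *s v + c *s w \<in> sum_list ` listset [U, span {u}, span {v}, span {w}]"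
      by (rule rev_image_eqI) (simp add: add.assoc)
  qed (auto simp: set_Cons_def span_singleton add.assoc, blast)
next
  fix us assume us: "us \<in> listset [U, span {u}, span {v}, span {w}]" and 0: "sum_list us = 0"
  from us obtain y a b c where "y \<in> U" "us = [y, a *s u, b *s v, c *s w]"
    by (auto simp: set_Cons_def span_singleton)
  with 0 assms(3)[of y a b c] show "set us \<subseteq> {0}"
    by (simp add: add.assoc)
qed (use assms(1) in auto)

end

section \<open>A homogeneous basis\<close>

definition wL :: "int \<Rightarrow> wtilde"
  where "wL n = (witt_L n, 0)"

definition wI :: "int \<Rightarrow> wtilde"
  where "wI n = (0, itilde_class (tpow n))"

lemma itilde_class_add: "itilde_class (f + g) = itilde_class f + itilde_class g"
  by (rule itilde_eqI) simp

lemma itilde_class_lscale: "itilde_class (lscale c f) = iscale c (itilde_class f)"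
  by (rule itilde_eqI) simp

lemma lderiv_1 [simp]: "lderiv 1 = 0"
  using lderiv_const[of 1] by simp

lemma wI_0 [simp]: "wI 0 = 0"
  by (auto simp: wI_def prod_eq_iff intro!: itilde_eqI)

lemma lscale_tpow: "lscale c (tpow n) = Poly_Mapping.single n c"
  by (simp add: lscale_def mult_single)

lemma bracket_LL: "wbracket (wL n) (wL m) = wscale (of_int (m - n)) (wL (n + m))"
  by (simp add: wbracket_def wL_def witt_bracket_L wscale_def prod_eq_iff)
    (auto intro!: itilde_eqI)

lemma bracket_LI: "wbracket (wL n) (wI m) = wscale (of_int m) (wI (n + m))"
  by (auto simp: wbracket_def wL_def wI_def wscale_def witt_bracket_def witt_L_def prod_eq_iff
      lderiv_single mult_single lscale_def algebra_simps simp del: single_of_int intro!: itilde_eqI)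

lemma bracket_IL: "wbracket (wI m) (wL n) = wscale (- of_int m) (wI (n + m))"
  by (auto simp: wbracket_def wL_def wI_def wscale_def witt_bracket_def witt_L_def prod_eq_iff
      lderiv_single mult_single lscale_def algebra_simps simp del: single_of_int simp flip: single_uminus single_diff intro!: itilde_eqI)

lemma bracket_II: "wbracket (wI m) (wI n) = 0"
  by (auto simp: wbracket_def wI_def witt_bracket_def prod_eq_iff intro!: itilde_eqI)

lemmas bracket_basis = bracket_LL bracket_LI bracket_IL bracket_II

lemma basis_induct [case_names L I add scale]:
  assumes "\<And>n. P (wL n)" "\<And>m. m \<noteq> 0 \<Longrightarrow> P (wI m)"
    and add: "\<And>x y. P x \<Longrightarrow> P y \<Longrightarrow> P (x + y)" and scale: "\<And>c x. P x \<Longrightarrow> P (wscale c x)"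
  shows "P x"
proof -
  have 0: "P 0"
    using scale[OF assms(1)[of 0], of 0] by simp
  then have I: "P (wI m)" for m
    using assms(2) by (cases "m = 0") auto
  have "P (f, 0)" for f
  proof (induction f rule: laurent_induct)
    case zero
    then show ?case using 0 by (simp add: zero_prod_def)
  next
    case (add n c f)
    have "(Poly_Mapping.single n c + f, 0) = wscale c (wL (n - 1)) + (f, 0)"
      by (auto simp: wscale_def wL_def witt_L_def lscale_tpow)
    with add assms show ?case by simp
  qed
  moreover have "P (0, itilde_class g)" for g
  proof (induction g rule: laurent_induct)
    case zero
    have "(0, itilde_class 0) = (0 :: wtilde)"
      by (auto simp: prod_eq_iff intro!: itilde_eqI)
    then show ?case using 0 by simp
  next
    case (add n c f)
    have "(0, itilde_class (Poly_Mapping.single n c + f)) = wscale c (wI n) + (0, itilde_class f)"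
      using itilde_class_lscale[of c "tpow n"]
      by (simp add: wscale_def wI_def itilde_class_add lscale_tpow)
    with add I assms show ?case by simp
  qed
  ultimately have "P ((fst x, 0) + (0, itilde_class (itilde_rep (snd x))))"
    by (rule add)
  also have "(fst x, 0) + (0, itilde_class (itilde_rep (snd x))) = x"
    by (simp add: Quotient3_abs_rep[OF Quotient3_itilde])
  finally show ?thesis .
qed

section \<open>The grading by the adjoint action of the degree element\<close>

lemma linear_addD: "Vector_Spaces.linear s t f \<Longrightarrow> f (x + y) = f x + f y"
  unfolding Vector_Spaces.linear_iff by blast

lemma linear_scaleD: "Vector_Spaces.linear s t f \<Longrightarrow> f (s c x) = t c (f x)"
  unfolding Vector_Spaces.linear_iff by blast

lemma linear_eq_on_basis:
  assumes f: "Vector_Spaces.linear wscale s f" and g: "Vector_Spaces.linear wscale s g"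
    and "\<And>n. f (wL n) = g (wL n)" "\<And>m. m \<noteq> 0 \<Longrightarrow> f (wI m) = g (wI m)"
  shows "f x = g x"
  by (induction x rule: basis_induct)
    (simp_all add: assms linear_addD[OF f] linear_addD[OF g] linear_scaleD[OF f] linear_scaleD[OF g])

text \<open>
  An eigenvector of \<open>ad L\<^sub>0\<close> lies in the span of \<open>L\<^sub>n\<close> and \<open>I\<^sub>n\<close>, because \<open>ad L\<^sub>0\<close> acts diagonally on the
  coefficients. For \<open>n = 0\<close> the second component vanishes: an exact 1-form has no residue.
\<close>

lemma L0_homogeneous:
  assumes "wbracket (wL 0) x = wscale (of_int n) x"
  shows "\<exists>a b. x = wscale a (wL n) + wscale b (wI n)"
proof -
  let ?f = "fst x" and ?h = "derham (snd x)"
  have tpow_mult: "Poly_Mapping.lookup (tpow 1 * f) k = Poly_Mapping.lookup f (k - 1)" for f :: laurent and k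
    by (induction f rule: laurent_induct)
      (auto simp: distrib_left lookup_add mult_single lookup_single when_def)
  have f: "Poly_Mapping.lookup ?f k = 0" if "k \<noteq> n + 1" for k
  proof -
    have "Poly_Mapping.lookup (witt_bracket (tpow 1) ?f) k = Poly_Mapping.lookup (lscale (of_int n) ?f) k"
      using assms by (simp add: wbracket_def wscale_def wL_def witt_L_def prod_eq_iff)
    then have "(of_int k - 1) * Poly_Mapping.lookup ?f k = of_int n * Poly_Mapping.lookup ?f k"
      by (simp add: witt_bracket_def lookup_minus tpow_mult lderiv_single left_diff_distrib mult.commute[of ?f])
    then have "of_int (k - 1 - n) * Poly_Mapping.lookup ?f k = 0"
      by (simp add: algebra_simps)
    with that show ?thesis
      unfolding mult_eq_0_iff of_int_eq_0_iff by simp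
  qed
  have h: "Poly_Mapping.lookup ?h k = 0" if "k \<noteq> n - 1" for k
  proof -
    have "snd (wbracket (wL 0) x) = iscale (of_int n) (snd x)"
      by (simp add: assms wscale_def)
    then have "derham (vf_act (tpow 1) (snd x) - vf_act ?f 0) = derham (iscale (of_int n) (snd x))"
      by (simp add: wbracket_def wL_def witt_L_def)
    then have "lderiv (tpow 1 * ?h) = lscale (of_int n) ?h"
      by (simp only: derham_simps mult_zero_right lderiv_zero diff_zero)
    then have "Poly_Mapping.lookup (lderiv (tpow 1 * ?h)) k = Poly_Mapping.lookup (lscale (of_int n) ?h) k"
      by simp
    then have "(of_int k + 1) * Poly_Mapping.lookup ?h k = of_int n * Poly_Mapping.lookup ?h k"
      by (simp only: lookup_lderiv tpow_mult lookup_lscale) simp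
    then have "of_int (k + 1 - n) * Poly_Mapping.lookup ?h k = 0"
      by (simp add: algebra_simps)
    with that show ?thesis
      unfolding mult_eq_0_iff of_int_eq_0_iff by simp
  qed
  have res0: "Poly_Mapping.lookup (derham b) (- 1) = 0" for b
    by transfer simp
  define a b where "a = Poly_Mapping.lookup ?f (n + 1)" and "b = Poly_Mapping.lookup ?h (n - 1) / of_int n"
  have "?f = lscale a (witt_L n)"
    by (rule poly_mapping_eqI) (auto simp: a_def witt_L_def lookup_single when_def f)
  moreover have "?h = derham (iscale b (itilde_class (tpow n)))"
    using res0[of "snd x"]
    by (intro poly_mapping_eqI) (auto simp: b_def lderiv_single lookup_single when_def h)
  then have "snd x = iscale b (itilde_class (tpow n))"
    by (rule itilde_eqI)
  ultimately have "x = wscale a (wL n) + wscale b (wI n)"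
    by (auto simp: prod_eq_iff wscale_def wL_def wI_def)
  then show ?thesis by blast
qed

text \<open>
  Division of the coefficient of \<open>t\<^sup>k\<close> by \<open>k - s\<close>, the degree of \<open>t\<^sup>k\<partial>\<close> for \<open>s = 1\<close> and of \<open>t\<^sup>k\<close> itself for
  \<open>s = 0\<close>. As \<open>x / 0 = 0\<close>, the coefficient of degree \<open>0\<close> is sent to \<open>0\<close>.
\<close>

lift_definition ldiv :: "int \<Rightarrow> laurent \<Rightarrow> laurent" is "\<lambda>s f k. f k / of_int (k - s)"
  by (erule rev_finite_subset) auto

lemma lookup_ldiv [simp]: "Poly_Mapping.lookup (ldiv s f) k = Poly_Mapping.lookup f k / of_int (k - s)"
  by transfer simp

lift_definition idiv :: "itilde \<Rightarrow> itilde" is "ldiv 0"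
  unfolding eq_mod_const_iff
proof (rule poly_mapping_eqI)
  fix f g :: laurent and k assume "lderiv f = lderiv g"
  then have "Poly_Mapping.lookup (lderiv f) k = Poly_Mapping.lookup (lderiv g) k"
    by simp
  then show "Poly_Mapping.lookup (lderiv (ldiv 0 f)) k = Poly_Mapping.lookup (lderiv (ldiv 0 g)) k"
    by auto
qed

definition deg_inv :: "wtilde \<Rightarrow> wtilde"
  where "deg_inv x = (ldiv 1 (fst x), idiv (snd x))"

definition L_coeff :: "int \<Rightarrow> wtilde \<Rightarrow> complex"
  where "L_coeff n x = Poly_Mapping.lookup (fst x) (n + 1)"

text \<open>
  The class \<open>I\<^sub>n\<close> is read off from its differential \<open>n t\<^sup>n\<^sup>-\<^sup>1 dt\<close>, on which constants have no effect; for
  \<open>n = 0\<close> the value is \<open>0\<close>.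
\<close>

definition I_coeff :: "int \<Rightarrow> wtilde \<Rightarrow> complex"
  where "I_coeff n x = Poly_Mapping.lookup (derham (snd x)) (n - 1) / of_int n"

lemma linear_deg_inv: "Vector_Spaces.linear wscale wscale deg_inv"
proof -
  have ldiv: "ldiv s (f + g) = ldiv s f + ldiv s g" "ldiv s (lscale c f) = lscale c (ldiv s f)" for s f g c
    by (auto intro!: poly_mapping_eqI simp: lookup_add add_divide_distrib)
  have "idiv (a + b) = idiv a + idiv b" for a b
    by transfer (simp add: eq_mod_const_iff ldiv)
  moreover have "idiv (iscale c a) = iscale c (idiv a)" for a c
    by transfer (simp add: eq_mod_const_iff ldiv)
  ultimately show ?thesis
    unfolding Vector_Spaces.linear_iff deg_inv_def
    by (auto simp: vector_space_wscale wscale_def ldiv)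
qed

lemma linear_L_coeff: "Vector_Spaces.linear wscale (*) (L_coeff n)"
  unfolding Vector_Spaces.linear_iff
  by (simp add: vector_space_wscale vector_space_complex L_coeff_def wscale_def lookup_add)

lemma linear_I_coeff: "Vector_Spaces.linear wscale (*) (I_coeff n)"
  unfolding Vector_Spaces.linear_iff
  by (simp add: vector_space_wscale vector_space_complex I_coeff_def wscale_def lookup_add add_divide_distrib)

lemma deg_inv_wL: "deg_inv (wL n) = wscale (1 / of_int n) (wL n)"
proof -
  have "ldiv 1 (witt_L n) = lscale (1 / of_int n) (witt_L n)"
    by (rule poly_mapping_eqI) (auto simp: witt_L_def lookup_single when_def)
  moreover have "idiv 0 = 0"
    by transfer (auto simp: eq_mod_const_iff intro!: poly_mapping_eqI)
  ultimately show ?thesis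
    by (simp add: deg_inv_def wL_def wscale_def)
qed

lemma deg_inv_wI: "deg_inv (wI n) = wscale (1 / of_int n) (wI n)"
proof -
  have "ldiv 0 (tpow n) = lscale (1 / of_int n) (tpow n)"
    by (rule poly_mapping_eqI) (auto simp: lookup_single when_def)
  moreover have "ldiv 1 0 = 0"
    by (auto intro!: poly_mapping_eqI)
  ultimately show ?thesis
    by (simp add: deg_inv_def wI_def wscale_def idiv.abs_eq itilde_class_lscale)
qed

lemma coeff_basis [simp]:
  "L_coeff k (wL n) = (if n = k then 1 else 0)" "L_coeff k (wI n) = 0"
  "I_coeff k (wL n) = 0" "I_coeff k (wI n) = (if n = k \<and> k \<noteq> 0 then 1 else 0)"
  by (auto simp: L_coeff_def I_coeff_def wL_def wI_def witt_L_def lderiv_single lookup_single when_def)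

lemma linear_ad_L0: "Vector_Spaces.linear wscale wscale (wbracket (wL 0))"
  by (rule wt.linear_bracket_right)

lemma linear_minus_L0_part: "Vector_Spaces.linear wscale wscale (\<lambda>x. x - wscale (L_coeff 0 x) (wL 0))"
  unfolding Vector_Spaces.linear_iff linear_addD[OF linear_L_coeff] linear_scaleD[OF linear_L_coeff]
    wt.scale_left_distrib wt.scale_right_diff_distrib wt.scale_scale
  by (intro conjI allI vector_space_wscale add_diff_add refl)

text \<open>
  \<open>deg_inv\<close> inverts \<open>ad L\<^sub>0\<close> on both sides, up to the kernel \<open>\<complex> L\<^sub>0\<close>. The first identity is used to
  correct derivations, the second one to correct cocycles.
\<close>

lemma ad_L0_deg_inv: "wbracket (wL 0) (deg_inv x) = x - wscale (L_coeff 0 x) (wL 0)"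
proof (rule linear_eq_on_basis[where f = "\<lambda>x. wbracket (wL 0) (deg_inv x)"])
  show "Vector_Spaces.linear wscale wscale (\<lambda>x. wbracket (wL 0) (deg_inv x))"
    using Vector_Spaces.linear_compose[OF linear_deg_inv linear_ad_L0] by (simp add: o_def)
  show "wbracket (wL 0) (deg_inv (wL n)) = wL n - wscale (L_coeff 0 (wL n)) (wL 0)" for n
    by (cases "n = 0") (simp_all add: deg_inv_wL wt.bracket_scale_right wt.bracket_zero_right bracket_LL)
  show "wbracket (wL 0) (deg_inv (wI m)) = wI m - wscale (L_coeff 0 (wI m)) (wL 0)" if "m \<noteq> 0" for m
    using that by (simp add: deg_inv_wI wt.bracket_scale_right bracket_LI)
qed (rule linear_minus_L0_part)

lemma deg_inv_ad_L0: "deg_inv (wbracket (wL 0) x) = x - wscale (L_coeff 0 x) (wL 0)"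
proof (rule linear_eq_on_basis[where f = "\<lambda>x. deg_inv (wbracket (wL 0) x)"])
  show "Vector_Spaces.linear wscale wscale (\<lambda>x. deg_inv (wbracket (wL 0) x))"
    using Vector_Spaces.linear_compose[OF linear_ad_L0 linear_deg_inv] by (simp add: o_def)
next
  have "deg_inv (wscale c y) = wscale c (deg_inv y)" for c y
    by (rule linear_scaleD[OF linear_deg_inv])
  note deg_inv_scale = this
  have deg_inv_0: "deg_inv 0 = 0"
    using deg_inv_scale[of 0 0] by simp
  show "deg_inv (wbracket (wL 0) (wL n)) = wL n - wscale (L_coeff 0 (wL n)) (wL 0)" for n
    by (cases "n = 0") (simp_all add: deg_inv_0 deg_inv_scale deg_inv_wL bracket_LL)
  show "deg_inv (wbracket (wL 0) (wI m)) = wI m - wscale (L_coeff 0 (wI m)) (wL 0)" if "m \<noteq> 0" for m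
    using that by (simp add: deg_inv_scale deg_inv_wI bracket_LI)
qed (rule linear_minus_L0_part)

section \<open>The four cocycles\<close>

lemma res_uminus: "res (- f) = - res f"
  by (simp add: res_def)

lemma res_lscale_mult: "res (lscale c f * g) = c * res (f * g)" "res (f * lscale c g) = c * res (f * g)"
  by (simp_all add: lscale_def mult.assoc mult.left_commute[of f])

lemma lderiv_numeral: "lderiv (numeral k) = 0"
  by (metis lderiv_const single_numeral)

lemma res_double: "res (2 * f) = 2 * res f"
  by (simp only: mult_2 res_add)

lemma itilde_cases: obtains g where "a = itilde_class g"
  by (metis Quotient3_abs_rep[OF Quotient3_itilde])

lemma itilde_class_diff: "itilde_class (f - g) = itilde_class f - itilde_class g"
  by (rule itilde_eqI) simp

text \<open>
  \<open>\<Omega>\<^sub>1\<close> and \<open>\<Omega>\<^sub>2\<close>, and likewise \<open>\<delta>\<^sub>1\<close> and \<open>\<delta>\<^sub>2\<close>, come from crossed homomorphisms \<open>E\<close> of vector fields with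
  values in functions, \<open>E f = f'\<close> and \<open>E f = t\<^sup>-\<^sup>1 f\<close>. Pairing \<open>d(E f)\<close> with a function gives a cocycle: the
  cyclic sum of the cocycle condition is the residue of a total derivative.
\<close>

lemma pairing_cocycle:
  fixes E :: "laurent \<Rightarrow> laurent" and w :: "laurent \<Rightarrow> itilde \<Rightarrow> complex"
  assumes w: "\<And>f g. w f (itilde_class g) = res (g * lderiv (E f))"
    and add: "\<And>f g. E (f + g) = E f + E g" and scale: "\<And>c f. E (lscale c f) = lscale c (E f)"
    and crossed: "\<And>f g. E (witt_bracket f g) = f * lderiv (E g) - g * lderiv (E f)"
  shows "(\<lambda>x y. w (fst x) (snd y) - w (fst y) (snd x)) \<in> wt.Z2"
proof -
  have w_simps: "w (f + f') a = w f a + w f' a" "w f (a + b) = w f a + w f b"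
    "w (lscale c f) a = c * w f a" "w f (iscale c a) = c * w f a" for f f' a b c
  proof -
    obtain g h where "a = itilde_class g" "b = itilde_class h"
      by (metis itilde_cases)
    then show "w (f + f') a = w f a + w f' a" "w f (a + b) = w f a + w f b"
      "w (lscale c f) a = c * w f a" "w f (iscale c a) = c * w f a"
      by (simp_all add: w add scale res_add res_lscale_mult algebra_simps flip: itilde_class_add itilde_class_lscale)
  qed
  have "- (w (fst (wbracket x y)) (snd z) - w (fst z) (snd (wbracket x y)))
      + (w (fst (wbracket x z)) (snd y) - w (fst y) (snd (wbracket x z)))
      - (w (fst (wbracket y z)) (snd x) - w (fst x) (snd (wbracket y z))) = 0" for x y z
  proof -
    obtain f g h a b c where xyz: "x = (f, itilde_class a)" "y = (g, itilde_class b)" "z = (h, itilde_class c)"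
      by (metis itilde_cases surj_pair)
    show ?thesis
      using res_lderiv[of "b * (f * lderiv (E h) - h * lderiv (E f)) - c * (f * lderiv (E g) - g * lderiv (E f))
          - a * (g * lderiv (E h) - h * lderiv (E g))"]
      by (simp add: xyz wbracket_def vf_act.abs_eq w crossed res_add res_diff res_uminus algebra_simps
          del: res_lderiv flip: itilde_class_diff)
  qed
  then show ?thesis
    unfolding wt.Z2_iff Vector_Spaces.linear_iff
    by (simp add: vector_space_wscale vector_space_complex w_simps wscale_def algebra_simps)
qed

lemma lderiv_crossed: "lderiv (witt_bracket f g) = f * lderiv (lderiv g) - g * lderiv (lderiv f)"
  by (simp add: witt_bracket_def algebra_simps)

lemma tpow_crossed:
  "tpow (-1) * witt_bracket f g = f * lderiv (tpow (-1) * g) - g * lderiv (tpow (-1) * f)"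
  by (simp add: witt_bracket_def algebra_simps)

lemma Omega_1_cocycle: "Omega_1 \<in> wt.Z2"
  using pairing_cocycle[of omega1 lderiv] unfolding Omega_1_def[abs_def]
  by (simp add: omega1.abs_eq lderiv_crossed)

lemma Omega_2_cocycle: "Omega_2 \<in> wt.Z2"
  using pairing_cocycle[of omega2 "\<lambda>f. tpow (-1) * f"] tpow_crossed unfolding Omega_2_def[abs_def]
  by (simp add: omega2.abs_eq distrib_left lscale_def mult.left_commute del: lderiv_mult)

lemma Omega_Ab_cocycle: "Omega_Ab \<in> wt.Z2"
proof -
  have w: "omegaAb (itilde_class f) (itilde_class g) = res (f * lderiv g)" for f g
    by (rule omegaAb.abs_eq)
  have lin: "omegaAb (a + b) c = omegaAb a c + omegaAb b c" "omegaAb a (b + c) = omegaAb a b + omegaAb a c"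
    "omegaAb (iscale k a) b = k * omegaAb a b" "omegaAb a (iscale k b) = k * omegaAb a b" for a b c k
  proof -
    obtain f g h where "a = itilde_class f" "b = itilde_class g" "c = itilde_class h"
      by (metis itilde_cases)
    then show "omegaAb (a + b) c = omegaAb a c + omegaAb b c" "omegaAb a (b + c) = omegaAb a b + omegaAb a c"
      "omegaAb (iscale k a) b = k * omegaAb a b" "omegaAb a (iscale k b) = k * omegaAb a b"
      by (simp_all add: w res_add res_lscale_mult algebra_simps flip: itilde_class_add itilde_class_lscale)
  qed
  have alt: "omegaAb a a = 0" for a
  proof -
    obtain f where "a = itilde_class f" by (rule itilde_cases)
    then show ?thesis
      using res_lderiv[of "f * f"] by (simp add: w mult.commute[of "lderiv f"] res_double del: res_lderiv)
  qed
  have "- Omega_Ab (wbracket x y) z + Omega_Ab (wbracket x z) y - Omega_Ab (wbracket y z) x = 0" for x y z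
  proof -
    obtain f g h a b c where "x = (f, itilde_class a)" "y = (g, itilde_class b)" "z = (h, itilde_class c)"
      by (metis itilde_cases surj_pair)
    then show ?thesis
      by (simp add: Omega_Ab_def wbracket_def vf_act.abs_eq w res_diff algebra_simps flip: itilde_class_diff)
  qed
  then show ?thesis
    unfolding wt.Z2_iff Vector_Spaces.linear_iff
    by (simp add: vector_space_wscale vector_space_complex lin alt wscale_def Omega_Ab_def)
qed

lemma sum_monomials: "(\<Sum>i\<in>Poly_Mapping.keys f. Poly_Mapping.single i (Poly_Mapping.lookup f i)) = (f :: laurent)"
  by (rule poly_mapping_eqI)
    (simp add: lookup_sum lookup_single when_def sum.delta' in_keys_iff)

text \<open>
  The Virasoro cocycle is the Gelfand--Fuchs cocycle \<open>Res(f''' g dt) / 12\<close>. In this form the cocycle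
  condition is integration by parts.
\<close>

lemma Omega_Vir_eq_res:
  "Omega_Vir x y = res (lderiv (lderiv (lderiv (fst x))) * fst y) / 12"
proof -
  let ?f = "fst x" and ?g = "fst y"
  have lderiv_sum: "lderiv (sum F S) = (\<Sum>i\<in>S. lderiv (F i))" for F :: "int \<Rightarrow> laurent" and S
    by (induction S rule: infinite_finite_induct) auto
  have res_sum: "res (sum F S) = (\<Sum>i\<in>S. res (F i))" for F :: "int \<Rightarrow> laurent" and S
    by (simp add: res_def lookup_sum)
  have "res (lderiv (lderiv (lderiv ?f)) * ?g) = res (lderiv (lderiv (lderiv
      (\<Sum>i\<in>Poly_Mapping.keys ?f. Poly_Mapping.single i (Poly_Mapping.lookup ?f i))))
      * (\<Sum>j\<in>Poly_Mapping.keys ?g. Poly_Mapping.single j (Poly_Mapping.lookup ?g j)))"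
    by (simp only: sum_monomials)
  also have "\<dots> = (\<Sum>i\<in>Poly_Mapping.keys ?f. \<Sum>j\<in>Poly_Mapping.keys ?g.
      res (Poly_Mapping.single (i - 1 - 1 - 1 + j) (of_int (i - 1 - 1) * (of_int (i - 1) * (of_int i
        * Poly_Mapping.lookup ?f i)) * Poly_Mapping.lookup ?g j)))"
    by (simp only: lderiv_sum sum_distrib_left sum_distrib_right res_sum lderiv_single mult_single)
      (rule sum.swap)
  also have "\<dots> = 12 * Omega_Vir x y"
    unfolding Omega_Vir_def sum_distrib_left
    by (intro sum.cong refl)
      (auto simp: res_def lookup_single when_def vir_coeff_def power2_eq_square algebra_simps)
  finally show ?thesis by simp
qed

lemma Omega_Vir_cocycle: "Omega_Vir \<in> wt.Z2"
proof -
  let ?r = "\<lambda>f g. res (lderiv (lderiv (lderiv f)) * g)"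
  have alt: "?r f f = 0" for f
    using res_lderiv[of "lderiv (lderiv f) * f"] res_lderiv[of "lderiv f * lderiv f"]
    by (simp add: res_add mult.commute res_double del: res_lderiv)
  have cyclic: "- ?r (witt_bracket f g) h + ?r (witt_bracket f h) g - ?r (witt_bracket g h) f = 0" for f g h
  proof -
    \<comment> \<open>\<open>w f g = [f, g]'\<close>. The term \<open>[f, g]''' h = w'' h\<close> equals \<open>w h''\<close> up to a total derivative, and the
      cyclic sum of \<open>w h''\<close> is zero.\<close>
    define w where "w f g = f * lderiv (lderiv g) - g * lderiv (lderiv f)" for f g
    show ?thesis
      using res_lderiv[of "lderiv (w f h) * g - w f h * lderiv g - (lderiv (w f g) * h - w f g * lderiv h)
          - (lderiv (w g h) * f - w g h * lderiv f)"]
      by (simp add: w_def witt_bracket_def lderiv_numeral res_add res_diff res_uminus algebra_simps del: res_lderiv)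
  qed
  have "- Omega_Vir (wbracket x y) z + Omega_Vir (wbracket x z) y - Omega_Vir (wbracket y z) x = 0" for x y z
  proof -
    have "- (p / 12) + q / 12 - r / 12 = (- p + q - r) / 12" for p q r :: complex
      by (simp add: field_simps)
    then show ?thesis
      unfolding Omega_Vir_eq_res wbracket_def fst_conv by (simp only: cyclic div_0)
  qed
  then show ?thesis
    unfolding wt.Z2_iff Vector_Spaces.linear_iff
    by (simp add: vector_space_wscale vector_space_complex Omega_Vir_eq_res alt wscale_def res_add
        res_lscale_mult add_divide_distrib distrib_left distrib_right)
qed

lemma itilde_class_0: "itilde_class 0 = 0"
  by (rule itilde_eqI) simp

lemma Omega_Vir_basis:
  "Omega_Vir (wL n) (wL m) = vir_coeff n m" "Omega_Vir (wL n) (wI m) = 0"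
  "Omega_Vir (wI n) (wI m) = 0"
  by (simp_all add: wL_def wI_def Omega_Vir_L) (simp_all add: Omega_Vir_def)

lemma Omega_1_basis:
  "Omega_1 (wL n) (wL m) = 0" "Omega_1 (wL n) (wI m) = (if n + m = 0 then of_int (n * (n + 1)) else 0)"
  "Omega_1 (wI n) (wI m) = 0"
  by (auto simp: Omega_1_def wL_def wI_def omega1.abs_eq witt_L_def lderiv_single mult_single res_def
      lookup_single when_def simp flip: itilde_class_0)

lemma Omega_2_basis:
  "Omega_2 (wL n) (wL m) = 0" "Omega_2 (wL n) (wI m) = (if n + m = 0 then of_int n else 0)"
  "Omega_2 (wI n) (wI m) = 0"
  by (auto simp: Omega_2_def wL_def wI_def omega2.abs_eq witt_L_def lderiv_single mult_single res_def
      lookup_single when_def simp del: lderiv_mult simp flip: itilde_class_0)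

lemma Omega_Ab_basis:
  "Omega_Ab (wL n) (wL m) = 0" "Omega_Ab (wL n) (wI m) = 0"
  "Omega_Ab (wI n) (wI m) = (if n + m = 0 then of_int m else 0)"
  by (auto simp: Omega_Ab_def wL_def wI_def omegaAb.abs_eq lderiv_single mult_single res_def
      lookup_single when_def simp flip: itilde_class_0)

lemmas Omega_basis = Omega_Vir_basis Omega_1_basis Omega_2_basis Omega_Ab_basis

lemma ZL2_bilinear:
  assumes "a \<in> wt.ZL2"
  shows "a (x + y) z = a x z + a y z" "a x (y + z) = a x y + a x z"
    "a (x - y) z = a x z - a y z" "a x (y - z) = a x y - a x z"
    "a (wscale c x) y = c * a x y" "a x (wscale c y) = c * a x y"
    "a 0 y = 0" "a x 0 = 0"
proof -
  have l: "Vector_Spaces.linear wscale (*) (a x)" "Vector_Spaces.linear wscale (*) (\<lambda>x. a x y)" for x y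
    using assms unfolding wt.ZL2_iff by blast+
  show add: "a (x + y) z = a x z + a y z" "a x (y + z) = a x y + a x z" for x y z
    using linear_addD[OF l(2)] linear_addD[OF l(1)] by blast+
  show scale: "a (wscale c x) y = c * a x y" "a x (wscale c y) = c * a x y" for c x y
    using linear_scaleD[OF l(2)] linear_scaleD[OF l(1)] by blast+
  show "a (x - y) z = a x z - a y z" "a x (y - z) = a x y - a x z" for x y z
    using add(1)[of "x - y" y z] add(2)[of x "y - z" z] by simp_all
  show "a 0 y = 0" "a x 0 = 0"
    using scale(1)[of 0 0 y] scale(2)[of x 0 0] by simp_all
qed

lemma ZL2_leibniz:
  "a \<in> wt.ZL2 \<Longrightarrow> a (wbracket x y) z = a x (wbracket y z) + a (wbracket x z) y"
  unfolding wt.ZL2_iff by blast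

lemma Z2_bilinear:
  assumes "a \<in> wt.Z2"
  shows "a (x + y) z = a x z + a y z" "a x (y + z) = a x y + a x z"
    "a (x - y) z = a x z - a y z" "a x (y - z) = a x y - a x z"
    "a (wscale c x) y = c * a x y" "a x (wscale c y) = c * a x y"
    "a 0 y = 0" "a x 0 = 0"
  by (rule ZL2_bilinear[OF subsetD[OF wt.Z2_subset_ZL2 assms]])+

lemma Z2_antisym:
  assumes "a \<in> wt.Z2"
  shows "a x y = - a y x"
proof -
  have alt: "a u u = 0" for u
    using assms unfolding wt.Z2_iff by blast
  show ?thesis
  proof -
    have "a x y + a y x = a (x + y) (x + y) - a x x - a y y"
      by (simp only: Z2_bilinear[OF assms]) (simp add: algebra_simps)
    then show ?thesis
      by (simp add: alt eq_neg_iff_add_eq_0)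
  qed
qed

lemma Z2_eqI:
  assumes a: "a \<in> wt.Z2" and b: "b \<in> wt.Z2"
    and LL: "\<And>n m. a (wL n) (wL m) = b (wL n) (wL m)"
    and LI: "\<And>n m. m \<noteq> 0 \<Longrightarrow> a (wL n) (wI m) = b (wL n) (wI m)"
    and II: "\<And>n m. n \<noteq> 0 \<Longrightarrow> m \<noteq> 0 \<Longrightarrow> a (wI n) (wI m) = b (wI n) (wI m)"
  shows "a = b"
proof (intro ext)
  have lin: "Vector_Spaces.linear wscale (*) (c x)" "Vector_Spaces.linear wscale (*) (\<lambda>x. c x y)"
    if "c \<in> wt.Z2" for c x y
    using that unfolding wt.Z2_iff by blast+
  have L: "a (wL n) y = b (wL n) y" for n y
    by (rule linear_eq_on_basis[OF lin(1) lin(1)]) (simp_all add: a b LL LI)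
  have I: "a (wI n) y = b (wI n) y" if "n \<noteq> 0" for n y
  proof (rule linear_eq_on_basis[OF lin(1) lin(1)])
    show "a (wI n) (wL m) = b (wI n) (wL m)" for m
      using LI[OF that] Z2_antisym[OF a, of "wI n"] Z2_antisym[OF b, of "wI n"] by simp
  qed (simp_all add: a b II that)
  show "a x y = b x y" for x y
    by (rule linear_eq_on_basis[OF lin(2) lin(2)]) (simp_all add: a b L I)
qed

section \<open>Leibniz cocycles are alternating\<close>

lemma L_coeff_ad_L0: "L_coeff n (wbracket (wL 0) x) = of_int n * L_coeff n x"
proof (rule linear_eq_on_basis[where s = "(*)"])
  show "Vector_Spaces.linear wscale (*) (\<lambda>x. L_coeff n (wbracket (wL 0) x))"
    using Vector_Spaces.linear_compose[OF linear_ad_L0 linear_L_coeff] by (simp only: o_def)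
  show "Vector_Spaces.linear wscale (*) (\<lambda>x. of_int n * L_coeff n x)"
    by (rule wt.linear_fun_scale[OF linear_L_coeff])
qed (auto simp: bracket_basis linear_scaleD[OF linear_L_coeff])

text \<open>
  It suffices that the symmetrisation \<open>s\<close> of a Leibniz cocycle vanishes: the Leibniz identity with
  \<open>x = y\<close> gives \<open>s(x, [x, z]) = 0\<close>, which polarises to \<open>s(x, [y, z]) = - s(y, [x, z])\<close>. Taking \<open>x = L\<^sub>0\<close>
  and writing \<open>z\<close> as \<open>[L\<^sub>0, deg_inv z]\<close> plus a multiple of \<open>L\<^sub>0\<close> reduces \<open>s\<close> to the number
  \<open>\<sigma> = s(L\<^sub>0, L\<^sub>0)\<close>.
\<close>

lemma ZL2_subset_Z2: "wt.ZL2 \<subseteq> wt.Z2"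
proof
  fix a assume a: "a \<in> wt.ZL2"
  define s where "s x y = a x y + a y x" for x y
  note bil = ZL2_bilinear[OF a]
  have s_bil: "s (x + y) z = s x z + s y z" "s x (y + z) = s x y + s x z"
    "s (wscale c x) y = c * s x y" "s x (wscale c y) = c * s x y" for x y z c
    unfolding s_def bil by (simp_all add: algebra_simps)
  have s_self: "s x (wbracket x z) = 0" for x z
    using ZL2_leibniz[OF a, of x x z] by (simp only: wt.bracket_self bil s_def)
  have s_swap: "s x (wbracket y z) = - s y (wbracket x z)" for x y z
  proof -
    have "wbracket (x + y) z = wbracket x z + wbracket y z"
      by (rule linear_addD[OF wt.linear_bracket_left])
    then show ?thesis
      using s_self[of "x + y" z] by (simp only: s_bil s_self) (simp add: eq_neg_iff_add_eq_0 add.commute)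
  qed
  define \<sigma> where "\<sigma> = s (wL 0) (wL 0)"
  have decomp: "x = wbracket (wL 0) (deg_inv x) + wscale (L_coeff 0 x) (wL 0)" for x
    by (simp only: ad_L0_deg_inv diff_add_cancel)
  have s_L0: "s (wL 0) x = L_coeff 0 x * \<sigma>" for x
    using arg_cong[OF decomp, of "s (wL 0)" x] by (simp only: s_bil s_self \<sigma>_def) simp
  have s_eq: "s y z = (L_coeff 0 z * L_coeff 0 y - L_coeff 0 (wbracket y (deg_inv z))) * \<sigma>" for y z
  proof -
    have "s y z = s y (wbracket (wL 0) (deg_inv z)) + L_coeff 0 z * s y (wL 0)"
      using arg_cong[OF decomp, of "s y" z] by (simp only: s_bil)
    also have "s y (wL 0) = s (wL 0) y"
      by (simp add: s_def add.commute)
    finally show ?thesis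
      by (simp only: s_swap[of y "wL 0"] s_L0) (simp add: algebra_simps)
  qed
  have s_LL: "s (wL n) (wL (- n)) = - 2 * \<sigma>" if "n \<noteq> 0" for n
  proof -
    have "L_coeff 0 (wbracket (wL n) (deg_inv (wL (- n))))
        = 1 / of_int (- n) * (of_int (- n - n) * L_coeff 0 (wL (n + - n)))"
      by (simp only: deg_inv_wL wt.bracket_scale_right bracket_LL linear_scaleD[OF linear_L_coeff])
    also have "\<dots> = 2"
      using that by simp
    finally have "L_coeff 0 (wbracket (wL n) (deg_inv (wL (- n)))) = 2" .
    moreover have "L_coeff 0 (wL (- n)) = 0"
      using that by simp
    ultimately show ?thesis
      by (simp only: s_eq) simp
  qed
  \<comment> \<open>\<open>[L\<^sub>2, L\<^sub>-\<^sub>3] = -5 L\<^sub>-\<^sub>1\<close> and \<open>[L\<^sub>1, L\<^sub>-\<^sub>3] = -4 L\<^sub>-\<^sub>2\<close>, so this instance reads \<open>10 \<sigma> = - 8 \<sigma>\<close>.\<close>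
  have "s (wL 1) (wbracket (wL 2) (wL (- 3))) = - s (wL 2) (wbracket (wL 1) (wL (- 3)))"
    by (rule s_swap)
  then have "\<sigma> = 0"
    using s_LL[of 1] s_LL[of 2] by (simp only: bracket_LL s_bil) simp
  then have "s y z = 0" for y z
    by (simp add: s_eq)
  then have anti: "a x y = - a y x" for x y
    by (simp only: s_def eq_neg_iff_add_eq_0)
  show "a \<in> wt.Z2"
    unfolding wt.Z2_iff
  proof (intro conjI allI)
    show "a x x = 0" for x
      using anti[of x x] by (simp only: eq_neg_iff_add_eq_0) simp
    show "- a (wbracket x y) z + a (wbracket x z) y - a (wbracket y z) x = 0" for x y z
      by (simp only: ZL2_leibniz[OF a, of x y z] anti[of x "wbracket y z"]) simp
    show "Vector_Spaces.linear wscale (*) (a x)" "Vector_Spaces.linear wscale (*) (\<lambda>x. a x y)" for x y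
      using a unfolding wt.ZL2_iff by blast+
  qed
qed

context lie_algebra
begin

lemma bracket_antisym: "bracket x y = - bracket y x"
proof -
  have "bracket (x + y) (x + y) = bracket x (x + y) + bracket y (x + y)"
    by (rule linear_addD[OF linear_bracket_left])
  then show ?thesis
    by (simp add: bracket_self bracket_add_right eq_neg_iff_add_eq_0)
qed

lemma bracket_leibniz: "bracket (bracket x y) z = bracket x (bracket y z) + bracket (bracket x z) y"
proof -
  have 1: "bracket (bracket x y) z = - bracket z (bracket x y)"
    by (rule bracket_antisym)
  have "bracket (bracket x z) y = - bracket y (bracket x z)"
    by (rule bracket_antisym)
  also have "bracket y (bracket x z) = bracket y (- bracket z x)"
    by (rule arg_cong[OF bracket_antisym])
  also have "\<dots> = - bracket y (bracket z x)"
    using bracket_scale_right[of y "-1" "bracket z x"] by simp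
  finally have 2: "bracket (bracket x z) y = bracket y (bracket z x)"
    by simp
  have "bracket x (bracket y z) + bracket y (bracket z x) = - bracket z (bracket x y)"
    using jacobi[of x y z] by (simp add: eq_neg_iff_add_eq_0)
  then show ?thesis
    by (simp only: 1 2)
qed

lemma BL2_subset_ZL2: "BL2 \<subseteq> ZL2"
proof
  fix a assume "a \<in> BL2"
  then obtain f where f: "Vector_Spaces.linear scale (*) f" and a: "a = (\<lambda>x y. f (bracket x y))"
    unfolding BL2_def by blast
  show "a \<in> ZL2"
    unfolding ZL2_iff a
  proof (intro conjI allI)
    show "Vector_Spaces.linear scale (*) (\<lambda>y. f (bracket x y))" for x
      using Vector_Spaces.linear_compose[OF linear_bracket_right f] by (simp only: o_def)
    show "Vector_Spaces.linear scale (*) (\<lambda>x. f (bracket x y))" for y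
      using Vector_Spaces.linear_compose[OF linear_bracket_left f] by (simp only: o_def)
    show "f (bracket (bracket x y) z) = f (bracket x (bracket y z)) + f (bracket (bracket x z) y)" for x y z
      by (simp only: bracket_leibniz[of x y z] linear_addD[OF f])
  qed
qed

end

section \<open>Classification of the 2-cocycles\<close>

text \<open>
  The recursion for the coefficients \<open>\<gamma>\<^sub>n\<close> of a degree-preserving crossed homomorphism
  \<open>L\<^sub>n \<mapsto> \<gamma>\<^sub>n I\<^sub>n\<close>. Its instance with \<open>m = -1\<close> determines \<open>\<gamma>\<^bsub>n+1\<^esub>\<close> from \<open>\<gamma>\<^sub>n\<close> and \<open>\<gamma>\<^sub>-\<^sub>1\<close>, and the
  recursion is symmetric under \<open>n \<mapsto> -n\<close>, which gives the negative indices. The affine sequences are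
  the contributions of \<open>\<delta>\<^sub>1\<close>, with \<open>\<gamma>\<^sub>n = n + 1\<close>, and \<open>\<delta>\<^sub>2\<close>, with \<open>\<gamma>\<^sub>n = 1\<close>.
\<close>

lemma crossed_coeffs_affine_pos:
  fixes \<gamma> :: "int \<Rightarrow> complex"
  assumes "\<And>n m. n \<noteq> 0 \<Longrightarrow> m \<noteq> 0 \<Longrightarrow> n + m \<noteq> 0 \<Longrightarrow>
      of_int (m - n) * \<gamma> (n + m) = of_int m * \<gamma> m - of_int n * \<gamma> n"
    and "1 \<le> n"
  shows "\<gamma> n = (\<gamma> 1 + \<gamma> (- 1)) / 2 + (\<gamma> 1 - \<gamma> (- 1)) / 2 * of_int n"
  using assms(2)
proof (induction n rule: int_ge_induct)
  case base
  show ?case by (simp add: field_simps)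
next
  case (step n)
  have "of_int (n + 1) * \<gamma> (n + 1) = of_int (n + 2) * \<gamma> n - \<gamma> (- 1)"
    using assms(1)[of "n + 1" "- 1"] step.hyps by (simp add: algebra_simps)
  also have "\<dots> = of_int (n + 1) * ((\<gamma> 1 + \<gamma> (- 1)) / 2 + (\<gamma> 1 - \<gamma> (- 1)) / 2 * of_int (n + 1))"
    by (subst step.IH) (simp add: field_simps)
  finally show ?case
    using step.hyps unfolding mult_cancel_left of_int_eq_0_iff by auto
qed

lemma crossed_coeffs_affine:
  fixes \<gamma> :: "int \<Rightarrow> complex"
  assumes "\<And>n m. n \<noteq> 0 \<Longrightarrow> m \<noteq> 0 \<Longrightarrow> n + m \<noteq> 0 \<Longrightarrow>
      of_int (m - n) * \<gamma> (n + m) = of_int m * \<gamma> m - of_int n * \<gamma> n"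
  shows "\<exists>A B. \<forall>n. n \<noteq> 0 \<longrightarrow> \<gamma> n = A + B * of_int n"
proof (intro exI allI impI)
  fix n :: int assume "n \<noteq> 0"
  then consider "1 \<le> n" | "1 \<le> - n" by linarith
  then show "\<gamma> n = (\<gamma> 1 + \<gamma> (- 1)) / 2 + (\<gamma> 1 - \<gamma> (- 1)) / 2 * of_int n"
  proof cases
    case 1
    with assms show ?thesis by (rule crossed_coeffs_affine_pos)
  next
    case 2
    have "of_int (m - n) * \<gamma> (- (n + m)) = of_int m * \<gamma> (- m) - of_int n * \<gamma> (- n)"
      if "n \<noteq> 0" "m \<noteq> 0" "n + m \<noteq> 0" for n m
      using assms[of "- n" "- m"] that by (simp add: algebra_simps)
    from crossed_coeffs_affine_pos[of "\<lambda>k. \<gamma> (- k)", OF this 2] show ?thesis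
      by (simp add: field_simps)
  qed
qed

text \<open>
  The correcting functional is \<open>x \<mapsto> a(L\<^sub>0, deg_inv x)\<close>, whose coboundary agrees with \<open>a\<close> on \<open>L\<^sub>0\<close>. The
  functional may still be changed on \<open>L\<^sub>0\<close>, which is not of the form \<open>[L\<^sub>0, x]\<close>, and this removes the value at
  \<open>(L\<^sub>1, L\<^sub>-\<^sub>1)\<close>, because \<open>[L\<^sub>1, L\<^sub>-\<^sub>1] = -2 L\<^sub>0\<close>.
\<close>

lemma Z2_normalize:
  assumes a: "a \<in> wt.Z2"
  shows "\<exists>b\<in>wt.B2. (\<forall>x. (a - b) (wL 0) x = 0) \<and> (a - b) (wL 1) (wL (- 1)) = 0"
proof -
  note bil = Z2_bilinear[OF a]
  define f where "f x = a (wL 0) (deg_inv x) + (- a (wL 1) (wL (- 1)) / 2) * L_coeff 0 x" for x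
  have lin: "Vector_Spaces.linear wscale (*) f"
    unfolding Vector_Spaces.linear_iff f_def linear_addD[OF linear_deg_inv] linear_scaleD[OF linear_deg_inv]
      linear_addD[OF linear_L_coeff] linear_scaleD[OF linear_L_coeff] bil
    by (intro conjI allI vector_space_wscale vector_space_complex) (simp_all add: algebra_simps)
  have "a (wL 0) (wL 0) = 0"
    using a unfolding wt.Z2_iff by blast
  then have 1: "f (wbracket (wL 0) x) = a (wL 0) x" for x
    by (simp add: f_def L_coeff_ad_L0 deg_inv_ad_L0 bil)
  have "f (wL 0) = - a (wL 1) (wL (- 1)) / 2"
    by (simp add: f_def deg_inv_wL bil)
  then have 2: "f (wbracket (wL 1) (wL (- 1))) = a (wL 1) (wL (- 1))"
    by (simp add: bracket_LL linear_scaleD[OF lin] del: wt.scale_minus_left)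
  have "(\<lambda>x y. f (wbracket x y)) \<in> wt.B2"
    unfolding wt.B2_eq_BL2 wt.BL2_def using lin by blast
  with 1 2 show ?thesis
    by (intro bexI[of _ "\<lambda>x y. f (wbracket x y)"]) simp_all
qed

definition Omega_comb :: "complex \<Rightarrow> complex \<Rightarrow> complex \<Rightarrow> complex \<Rightarrow> wtilde \<Rightarrow> wtilde \<Rightarrow> complex"
  where "Omega_comb c\<^sub>1 c\<^sub>2 c\<^sub>3 c\<^sub>4 = form_scale c\<^sub>1 Omega_Vir + form_scale c\<^sub>2 Omega_1
    + form_scale c\<^sub>3 Omega_2 + form_scale c\<^sub>4 Omega_Ab"

lemma Omega_comb_apply: "Omega_comb c\<^sub>1 c\<^sub>2 c\<^sub>3 c\<^sub>4 x y =
    c\<^sub>1 * Omega_Vir x y + c\<^sub>2 * Omega_1 x y + c\<^sub>3 * Omega_2 x y + c\<^sub>4 * Omega_Ab x y"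
  by (simp add: Omega_comb_def fun_scale_def)

lemma Omega_comb_Z2: "Omega_comb c\<^sub>1 c\<^sub>2 c\<^sub>3 c\<^sub>4 \<in> wt.Z2"
  unfolding Omega_comb_def
  by (intro form.subspace_add form.subspace_scale wt.subspace_Z2
      Omega_Vir_cocycle Omega_1_cocycle Omega_2_cocycle Omega_Ab_cocycle)

text \<open>
  By \<open>weight\<close> only pairs of opposite degrees matter. On the Witt algebra, the triple
  \<open>(L\<^sub>n, L\<^sub>1, L\<^bsub>-n-1\<^esub>)\<close> gives a recursion of first order, which determines everything from the value at
  \<open>(L\<^sub>2, L\<^sub>-\<^sub>2)\<close>. The mixed values \<open>\<beta>\<^sub>n = a(L\<^sub>n, I\<^sub>-\<^sub>n)\<close> become an instance of the recursion above after
  division by \<open>n\<close>. On the ideal, the triple \<open>(L\<^bsub>-1-m\<^esub>, I\<^sub>1, I\<^sub>m)\<close> determines all values from the one at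
  \<open>(I\<^sub>-\<^sub>1, I\<^sub>1)\<close>.
\<close>

lemma Z2_classify_normalized:
  assumes a: "a \<in> wt.Z2" and L0: "\<And>x. a (wL 0) x = 0" and L1: "a (wL 1) (wL (- 1)) = 0"
  shows "\<exists>c\<^sub>1 c\<^sub>2 c\<^sub>3 c\<^sub>4. a = Omega_comb c\<^sub>1 c\<^sub>2 c\<^sub>3 c\<^sub>4"
proof -
  note bil = Z2_bilinear[OF a] and anti = Z2_antisym[OF a]
  have leibniz: "a (wbracket x y) z = a x (wbracket y z) + a (wbracket x z) y" for x y z
    using a wt.Z2_subset_ZL2 by (blast intro: ZL2_leibniz)
  have weight: "a x y = 0" if "wbracket (wL 0) x = wscale (of_int n) x"
    "wbracket (wL 0) y = wscale (of_int m) y" "n + m \<noteq> 0" for x y n m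
  proof -
    have "of_int n * a x y = of_int m * a y x"
      using leibniz[of "wL 0" x y] by (simp add: that L0 bil)
    then have "of_int (n + m) * a x y = 0"
      using anti[of y x] by (simp add: algebra_simps)
    with that(3) show ?thesis
      unfolding mult_eq_0_iff of_int_eq_0_iff by simp
  qed
  have wtL: "wbracket (wL 0) (wL n) = wscale (of_int n) (wL n)"
    and wtI: "wbracket (wL 0) (wI n) = wscale (of_int n) (wI n)" for n
    by (simp_all add: bracket_basis)

  define c\<^sub>1 where "c\<^sub>1 = 2 * a (wL 2) (wL (- 2))"
  have LL_ge2: "a (wL n) (wL (- n)) = c\<^sub>1 * (of_int (n * (n\<^sup>2 - 1)) / 12)" if "2 \<le> n" for n
    using that
  proof (induction n rule: int_ge_induct)
    case base
    show ?case by (simp add: c\<^sub>1_def)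
  next
    case (step n)
    have "a (wL (- 1)) (wL 1) = 0"
      using anti[of "wL (- 1)"] L1 by simp
    then have "of_int (n - 1) * a (wL (n + 1)) (wL (- (n + 1))) = of_int (n + 2) * a (wL n) (wL (- n))"
      using leibniz[of "wL n" "wL 1" "wL (- (n + 1))"] by (simp only: bracket_LL bil) (simp add: algebra_simps)
    also have "\<dots> = of_int (n - 1) * (c\<^sub>1 * (of_int ((n + 1) * ((n + 1)\<^sup>2 - 1)) / 12))"
      by (simp add: step.IH power2_eq_square algebra_simps)
    finally show ?case
      using step.hyps unfolding mult_cancel_left of_int_eq_0_iff by auto
  qed
  have LL: "a (wL n) (wL (- n)) = c\<^sub>1 * (of_int (n * (n\<^sup>2 - 1)) / 12)" for n
  proof -
    consider "2 \<le> n" | "n = 1" | "n = 0" | "n = - 1" | "2 \<le> - n" by linarith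
    then show ?thesis
    proof cases
      case 5
      then show ?thesis
        using LL_ge2[of "- n"] anti[of "wL n" "wL (- n)"] by (simp add: algebra_simps)
    qed (use LL_ge2 L0 L1 anti[of "wL (- 1)"] in auto)
  qed

  define \<beta> where "\<beta> n = a (wL n) (wI (- n))" for n
  have \<beta>: "of_int (m - n) * \<beta> (n + m) = of_int (n + m) * (\<beta> m - \<beta> n)" for n m
    using leibniz[of "wL n" "wL m" "wI (- (n + m))"] anti[of "wI (- m)" "wL m"]
    by (simp only: bracket_basis bil \<beta>_def) (simp add: algebra_simps)
  have crossed: "of_int (m - n) * (\<beta> (n + m) / of_int (n + m)) = of_int m * (\<beta> m / of_int m) - of_int n * (\<beta> n / of_int n)"
    if "n \<noteq> 0" "m \<noteq> 0" "n + m \<noteq> 0" for n m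
  proof -
    have "of_int (n + m) \<noteq> (0 :: complex)"
      using that(3) unfolding of_int_eq_0_iff .
    then have "of_int (m - n) * (\<beta> (n + m) / of_int (n + m)) = \<beta> m - \<beta> n"
      by (metis \<beta> nonzero_mult_div_cancel_left times_divide_eq_right)
    moreover have "of_int m * (\<beta> m / of_int m) = \<beta> m" "of_int n * (\<beta> n / of_int n) = \<beta> n"
      using that(1,2) by simp_all
    ultimately show ?thesis
      by (simp only:)
  qed
  obtain A B where AB: "\<And>n. n \<noteq> 0 \<Longrightarrow> \<beta> n / of_int n = A + B * of_int n"
    using crossed_coeffs_affine[of "\<lambda>n. \<beta> n / of_int n", OF crossed] by blast
  have LI: "\<beta> n = B * of_int (n * (n + 1)) + (A - B) * of_int n" for n
  proof (cases "n = 0")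
    case True
    then show ?thesis by (simp add: \<beta>_def L0)
  next
    case False
    then have "\<beta> n = (A + B * of_int n) * of_int n"
      using AB[of n] by (simp only: nonzero_divide_eq_eq of_int_eq_0_iff simp_thms)
    then show ?thesis
      by (simp add: algebra_simps)
  qed

  define c\<^sub>4 where "c\<^sub>4 = a (wI (- 1)) (wI 1)"
  have II: "a (wI (- m)) (wI m) = c\<^sub>4 * of_int m" for m
    using leibniz[of "wL (- 1 - m)" "wI 1" "wI m"]
    by (simp add: bracket_basis bil c\<^sub>4_def mult.commute)

  have "a = Omega_comb c\<^sub>1 B (A - B) c\<^sub>4"
  proof (rule Z2_eqI[OF a Omega_comb_Z2])
    fix n m :: int
    show "a (wL n) (wL m) = Omega_comb c\<^sub>1 B (A - B) c\<^sub>4 (wL n) (wL m)"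
    proof (cases "n + m = 0")
      case True
      then have "m = - n" by simp
      then show ?thesis
        using LL by (simp add: Omega_comb_apply Omega_basis vir_coeff_def)
    qed (use weight[OF wtL wtL] in \<open>simp add: Omega_comb_apply Omega_basis vir_coeff_def\<close>)
    show "a (wL n) (wI m) = Omega_comb c\<^sub>1 B (A - B) c\<^sub>4 (wL n) (wI m)"
    proof (cases "n + m = 0")
      case True
      then have "m = - n" by simp
      then show ?thesis
        using LI[of n] by (simp add: Omega_comb_apply Omega_basis \<beta>_def)
    qed (use weight[OF wtL wtI] in \<open>simp add: Omega_comb_apply Omega_basis\<close>)
    show "a (wI n) (wI m) = Omega_comb c\<^sub>1 B (A - B) c\<^sub>4 (wI n) (wI m)"
    proof (cases "n + m = 0")
      case True
      then have "n = - m" by simp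
      then show ?thesis
        using II[of m] by (simp add: Omega_comb_apply Omega_basis)
    qed (use weight[OF wtI wtI] in \<open>simp add: Omega_comb_apply Omega_basis\<close>)
  qed
  then show ?thesis by blast
qed

lemma Z2_classify: "a \<in> wt.Z2 \<Longrightarrow> \<exists>b\<in>wt.B2. \<exists>c\<^sub>1 c\<^sub>2 c\<^sub>3 c\<^sub>4. a = b + Omega_comb c\<^sub>1 c\<^sub>2 c\<^sub>3 c\<^sub>4"
proof -
  assume a: "a \<in> wt.Z2"
  from Z2_normalize[OF a] obtain b where b: "b \<in> wt.B2" "\<And>x. (a - b) (wL 0) x = 0"
    "(a - b) (wL 1) (wL (- 1)) = 0" by blast
  have "b \<in> wt.Z2"
    using b(1) wt.BL2_subset_ZL2 ZL2_subset_Z2 by (auto simp: wt.B2_eq_BL2)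
  then have "a - b \<in> wt.Z2"
    by (intro form.subspace_diff wt.subspace_Z2 a)
  from Z2_classify_normalized[OF this b(2,3)] obtain c\<^sub>1 c\<^sub>2 c\<^sub>3 c\<^sub>4 where "a - b = Omega_comb c\<^sub>1 c\<^sub>2 c\<^sub>3 c\<^sub>4"
    by blast
  then have "a = b + Omega_comb c\<^sub>1 c\<^sub>2 c\<^sub>3 c\<^sub>4"
    by (metis add.commute diff_add_cancel)
  with b(1) show ?thesis by blast
qed

text \<open>
  If the combination is \<open>(x, y) \<mapsto> f([x, y])\<close>, then \<open>(L\<^sub>1, L\<^sub>-\<^sub>1)\<close> shows \<open>f(L\<^sub>0) = 0\<close>; all other pairs used
  have a bracket in \<open>\<complex> L\<^sub>0\<close>, so that the combination vanishes on them.
\<close>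

lemma Omega_independent:
  assumes "Omega_comb c\<^sub>1 c\<^sub>2 c\<^sub>3 c\<^sub>4 \<in> wt.B2"
  shows "c\<^sub>1 = 0 \<and> c\<^sub>2 = 0 \<and> c\<^sub>3 = 0 \<and> c\<^sub>4 = 0"
proof -
  obtain f where f: "Vector_Spaces.linear wscale (*) f" "Omega_comb c\<^sub>1 c\<^sub>2 c\<^sub>3 c\<^sub>4 = (\<lambda>x y. f (wbracket x y))"
    using assms unfolding wt.B2_eq_BL2 wt.BL2_def by blast
  have eq: "Omega_comb c\<^sub>1 c\<^sub>2 c\<^sub>3 c\<^sub>4 x y = f (wbracket x y)" for x y
    by (simp add: f(2))
  have fs: "f (wscale c x) = c * f x" for c x
    by (rule linear_scaleD[OF f(1)])
  have f0: "f 0 = 0"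
    using fs[of 0 0] by simp
  have "f (wL 0) = 0"
    using eq[of "wL 1" "wL (- 1)"] by (simp add: Omega_comb_apply Omega_basis vir_coeff_def bracket_LL fs
        del: wt.scale_minus_left)
  then have "c\<^sub>1 = 0"
    using eq[of "wL 2" "wL (- 2)"] by (simp add: Omega_comb_apply Omega_basis vir_coeff_def bracket_LL fs
        del: wt.scale_minus_left)
  moreover have "c\<^sub>3 = 0"
    using eq[of "wL (- 1)" "wI 1"] by (simp add: Omega_comb_apply Omega_basis bracket_LI f0)
  moreover from this have "c\<^sub>2 = 0"
    using eq[of "wL 1" "wI (- 1)"] by (simp add: Omega_comb_apply Omega_basis bracket_LI f0)
  moreover have "c\<^sub>4 = 0"
    using eq[of "wI (- 1)" "wI 1"] by (simp add: Omega_comb_apply Omega_basis bracket_II f0)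
  ultimately show ?thesis by simp
qed

section \<open>Derivations\<close>

context lie_algebra
begin

lemma bracket_add_left: "bracket (x + y) z = bracket x z + bracket y z"
  by (rule linear_addD[OF linear_bracket_left])

lemma bracket_scale_left: "bracket (scale c x) y = scale c (bracket x y)"
  by (rule linear_scaleD[OF linear_bracket_left])

lemma bracket_uminus_left: "bracket (- x) y = - bracket x y"
  using bracket_scale_left[of "-1" x y] by simp

lemma Inn_eq_B1_ad: "Inn = B1_ad"
  unfolding Inn_def B1_ad_def coboundaries1_def
proof (intro equalityI image_subsetI)
  have ad: "d0 bracket (- x) = bracket x" for x
  proof
    fix y
    have "d0 bracket (- x) y = bracket y (- x)"
      by (simp only: d0_def)
    also have "\<dots> = - bracket (- x) y"
      by (rule bracket_antisym)
    finally show "d0 bracket (- x) y = bracket x y"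
      by (simp only: bracket_uminus_left minus_minus)
  qed
  show "bracket x \<in> range (d0 bracket)" for x
    using rangeI[of "d0 bracket" "- x"] by (simp only: ad)
  show "d0 bracket x \<in> range bracket" for x
  proof -
    have "d0 bracket x = bracket (- x)"
      using ad[of "- x"] by (simp only: minus_minus)
    then show ?thesis by (simp only: rangeI)
  qed
qed

lemma Der_eq_Z1_ad: "Der = Z1_ad"
proof -
  have "d1 bracket c = 0 \<longleftrightarrow> (\<forall>x y. c (bracket x y) = bracket (c x) y + bracket x (c y))" for c
  proof -
    have "d1 bracket c x y = (bracket (c x) y + bracket x (c y)) - c (bracket x y)" for x y
      by (simp only: d1_def bracket_antisym[of "c x" y]) simp
    then have "d1 bracket c x y = 0 \<longleftrightarrow> c (bracket x y) = bracket (c x) y + bracket x (c y)" for x y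
      by (simp only: right_minus_eq eq_commute[of "c (bracket x y)"])
    then show ?thesis
      by (simp only: fun_eq_iff zero_fun_def)
  qed
  then show ?thesis
    unfolding Der_def Z1_ad_def cocycles1_def cochains1_def by simp
qed

lemma Inn_subset_Der: "Inn \<subseteq> Der"
  unfolding Inn_def Der_def
proof (intro image_subsetI CollectI conjI allI)
  show "bracket z (bracket x y) = bracket (bracket z x) y + bracket x (bracket z y)" for z x y
    by (simp only: bracket_leibniz[of z x y] bracket_antisym[of x "bracket z y"]) simp
qed (rule linear_bracket_right)

end

lemma DerI:
  assumes "\<And>x y. D (x + y) = D x + D y" "\<And>c x. D (wscale c x) = wscale c (D x)"
    and "\<And>x y. D (wbracket x y) = wbracket (D x) y + wbracket x (D y)"
  shows "D \<in> wt.Der"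
  unfolding wt.Der_def Vector_Spaces.linear_iff using assms by (blast intro: vector_space_wscale)

text \<open>
  The counterpart of \<open>pairing_cocycle\<close> for derivations that vanish on the abelian ideal.
\<close>

lemma crossed_derivation:
  assumes add: "\<And>f g. E (f + g) = E f + E g" and scale: "\<And>c f. E (lscale c f) = lscale c (E f)"
    and crossed: "\<And>f g. E (witt_bracket f g) = f * lderiv (E g) - g * lderiv (E f)"
  shows "(\<lambda>x. (0, itilde_class (E (fst x)))) \<in> wt.Der"
proof (rule DerI)
  show "(0, itilde_class (E (fst (wbracket x y)))) = wbracket (0, itilde_class (E (fst x))) y
      + wbracket x (0, itilde_class (E (fst y)))" for x y
  proof -
    have "witt_bracket 0 f = 0" "witt_bracket f 0 = 0" for f
      by (simp_all add: witt_bracket_def)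
    then show ?thesis
      by (auto simp: wbracket_def crossed prod_eq_iff intro!: itilde_eqI)
  qed
qed (simp_all add: add scale itilde_class_add itilde_class_lscale wscale_def)

lemma delta1_Der: "delta1 \<in> wt.Der"
  using crossed_derivation[of lderiv] lderiv_crossed by (simp add: delta1_eq[abs_def])

lemma delta2_Der: "delta2 \<in> wt.Der"
  using crossed_derivation[of "\<lambda>f. tpow (-1) * f"] tpow_crossed
  by (simp add: delta2_eq[abs_def] distrib_left lscale_def mult.left_commute del: lderiv_mult)

lemma d_Ab_Der: "d_Ab \<in> wt.Der"
  by (rule DerI)
    (auto simp: d_Ab_def wbracket_def wscale_def witt_bracket_def prod_eq_iff intro!: itilde_eqI)

lemma delta_basis:
  "delta1 (wL n) = wscale (of_int (n + 1)) (wI n)" "delta1 (wI n) = 0"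
  "delta2 (wL n) = wI n" "delta2 (wI n) = 0"
  "d_Ab (wL n) = 0" "d_Ab (wI n) = wI n"
  by (simp_all add: delta1_eq delta2_eq d_Ab_def wL_def wI_def wscale_def witt_L_def lderiv_single
      mult_single lscale_tpow itilde_class_0 zero_prod_def flip: itilde_class_lscale)

definition delta_comb :: "complex \<Rightarrow> complex \<Rightarrow> complex \<Rightarrow> wtilde \<Rightarrow> wtilde"
  where "delta_comb c\<^sub>1 c\<^sub>2 c\<^sub>3 = fun_scale wscale c\<^sub>1 delta1 + fun_scale wscale c\<^sub>2 delta2
    + fun_scale wscale c\<^sub>3 d_Ab"

lemma delta_comb_apply: "delta_comb c\<^sub>1 c\<^sub>2 c\<^sub>3 x = wscale c\<^sub>1 (delta1 x) + wscale c\<^sub>2 (delta2 x) + wscale c\<^sub>3 (d_Ab x)"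
  by (simp add: delta_comb_def fun_scale_def)

lemma delta_comb_basis:
  "delta_comb c\<^sub>1 c\<^sub>2 c\<^sub>3 (wL n) = wscale (c\<^sub>1 * of_int (n + 1) + c\<^sub>2) (wI n)"
  "delta_comb c\<^sub>1 c\<^sub>2 c\<^sub>3 (wI n) = wscale c\<^sub>3 (wI n)"
  by (simp_all only: delta_comb_apply delta_basis wt.scale_left_distrib wt.scale_scale wt.scale_zero_right
      add_0_left add_0_right)

lemma subspace_Der: "wt.endo.subspace wt.Der"
  by (simp only: wt.Der_eq_Z1_ad wt.subspace_Z1_ad)

lemma subspace_Inn: "wt.endo.subspace wt.Inn"
  by (simp only: wt.Inn_eq_B1_ad wt.subspace_B1_ad)

lemma delta_comb_Der: "delta_comb c\<^sub>1 c\<^sub>2 c\<^sub>3 \<in> wt.Der"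
  unfolding delta_comb_def
  by (intro wt.endo.subspace_add wt.endo.subspace_scale subspace_Der delta1_Der delta2_Der d_Ab_Der)

text \<open>
  The bracket \<open>[L\<^sub>n, L\<^sub>m]\<close> vanishes for \<open>n = m\<close> and gives no information there, so additivity is only
  available for distinct indices. Then \<open>a 0 = a 1 = 0\<close> still makes \<open>a\<close> constant from \<open>2\<close> on, and
  \<open>5 = 2 + 3\<close> forces the constant to be \<open>0\<close>.
\<close>

lemma almost_additive_eq_0:
  fixes a :: "int \<Rightarrow> complex"
  assumes add: "\<And>n m. n \<noteq> m \<Longrightarrow> a (n + m) = a n + a m" and "a 0 = 0" "a 1 = 0"
  shows "a n = 0"
proof -
  have eq2: "a n = a 2" if "2 \<le> n" for n
    using that
  proof (induction n rule: int_ge_induct)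
    case (step n)
    then show ?case
      using add[of n 1] \<open>a 1 = 0\<close> by simp
  qed simp
  have "a 2 = 0"
    using add[of 2 3] eq2[of 3] eq2[of 5] by simp
  with eq2 have ge2: "a n = 0" if "2 \<le> n" for n
    using that by simp
  have neg: "a (- n) = - a n" if "n \<noteq> 0" for n
    using add[of n "- n"] that \<open>a 0 = 0\<close> by (simp add: eq_neg_iff_add_eq_0 add.commute)
  consider "2 \<le> n" | "n = 1" | "n = 0" | "n = - 1" | "2 \<le> - n" by linarith
  then show ?thesis
  proof cases
    case 5
    then show ?thesis using neg[of n] ge2[of "- n"] by simp
  qed (use ge2 neg[of 1] \<open>a 0 = 0\<close> \<open>a 1 = 0\<close> in auto)
qed

lemma Der_rules:
  assumes "D \<in> wt.Der"
  shows "D (wbracket x y) = wbracket (D x) y + wbracket x (D y)"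
    "D (x + y) = D x + D y" "D (wscale c x) = wscale c (D x)" "D 0 = 0"
proof -
  have lin: "Vector_Spaces.linear wscale wscale D"
    using assms unfolding wt.Der_def by blast
  show "D (wbracket x y) = wbracket (D x) y + wbracket x (D y)"
    using assms unfolding wt.Der_def by blast
  show "D (x + y) = D x + D y"
    by (rule linear_addD[OF lin])
  show scale: "D (wscale c x) = wscale c (D x)" for c x
    by (rule linear_scaleD[OF lin])
  show "D 0 = 0"
    using scale[of 0 0] by simp
qed

lemma Der_eqI:
  assumes D: "D \<in> wt.Der" "D' \<in> wt.Der" and "\<And>n. D (wL n) = D' (wL n)" "\<And>m. m \<noteq> 0 \<Longrightarrow> D (wI m) = D' (wI m)"
  shows "D = D'"
proof
  have "Vector_Spaces.linear wscale wscale D" "Vector_Spaces.linear wscale wscale D'"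
    using D unfolding wt.Der_def by blast+
  then show "D x = D' x" for x
    by (rule linear_eq_on_basis) (rule assms, assumption?)+
qed

lemma Der_homogeneous:
  assumes D: "D \<in> wt.Der" and D0: "D (wL 0) = 0" and x: "wbracket (wL 0) x = wscale (of_int n) x"
  shows "\<exists>a b. D x = wscale a (wL n) + wscale b (wI n)"
proof (rule L0_homogeneous)
  have "D (wbracket (wL 0) x) = wbracket 0 x + wbracket (wL 0) (D x)"
    by (simp only: Der_rules(1)[OF D] D0)
  also have "wbracket 0 x = 0"
    using wt.bracket_scale_left[of 0 0 x] by simp
  finally show "wbracket (wL 0) (D x) = wscale (of_int n) (D x)"
    by (simp only: x Der_rules(3)[OF D] add_0_left)
qed

lemmas coeff_linear =
  linear_addD[OF linear_L_coeff] linear_scaleD[OF linear_L_coeff]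
  linear_addD[OF linear_I_coeff] linear_scaleD[OF linear_I_coeff]

lemma coeff_zero: "L_coeff n 0 = 0" "I_coeff n 0 = 0"
  by (simp_all add: L_coeff_def I_coeff_def)

lemmas bracket_bilinear =
  wt.bracket_add_left wt.bracket_add_right wt.bracket_scale_left wt.bracket_scale_right

text \<open>
  Such a derivation preserves degrees, so \<open>D L\<^sub>n = a\<^sub>n L\<^sub>n + b\<^sub>n I\<^sub>n\<close> and \<open>D I\<^sub>n = e\<^sub>n L\<^sub>n + g\<^sub>n I\<^sub>n\<close>. Brackets of
  two \<open>L\<close> give \<open>a = 0\<close> and the recursion of \<open>crossed_coeffs_affine\<close> for \<open>b\<close>. Applying \<open>D\<close> to
  \<open>[L\<^sub>-\<^sub>m, I\<^sub>m] = m I\<^sub>0 = 0\<close> gives \<open>e = 0\<close>, and the other brackets \<open>[L\<^sub>n, I\<^sub>m]\<close> make \<open>g\<close> constant.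
\<close>

lemma Der_classify_normalized:
  assumes D: "D \<in> wt.Der" and D0: "D (wL 0) = 0" and D1: "D (wL 1) = wscale q (wI 1)"
  shows "\<exists>c\<^sub>1 c\<^sub>2 c\<^sub>3. D = delta_comb c\<^sub>1 c\<^sub>2 c\<^sub>3"
proof -
  note Dr = Der_rules[OF D]
  have "\<forall>n. \<exists>a b. D (wL n) = wscale a (wL n) + wscale b (wI n)"
    by (intro allI Der_homogeneous[OF D D0]) (simp add: bracket_basis)
  then obtain a b where DL: "\<And>n. D (wL n) = wscale (a n) (wL n) + wscale (b n) (wI n)"
    by metis
  have "\<forall>n. \<exists>e g. D (wI n) = wscale e (wL n) + wscale g (wI n)"
    by (intro allI Der_homogeneous[OF D D0]) (simp add: bracket_basis)
  then obtain e g where DI: "\<And>n. D (wI n) = wscale (e n) (wL n) + wscale (g n) (wI n)"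
    by metis

  have LL: "wscale (of_int (m - n)) (wscale (a (n + m)) (wL (n + m)) + wscale (b (n + m)) (wI (n + m)))
      = wscale (a n) (wscale (of_int (m - n)) (wL (n + m))) + wscale (b n) (wscale (- of_int n) (wI (m + n)))
      + (wscale (a m) (wscale (of_int (m - n)) (wL (n + m))) + wscale (b m) (wscale (of_int m) (wI (n + m))))"
    for n m
    using Dr(1)[of "wL n" "wL m"] by (simp only: bracket_basis Dr(3) DL bracket_bilinear)
  have LI: "wscale (of_int m) (wscale (e (n + m)) (wL (n + m)) + wscale (g (n + m)) (wI (n + m)))
      = wscale (a n) (wscale (of_int m) (wI (n + m))) + wscale (b n) 0
      + (wscale (e m) (wscale (of_int (m - n)) (wL (n + m))) + wscale (g m) (wscale (of_int m) (wI (n + m))))"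
    for n m
    using Dr(1)[of "wL n" "wI m"] by (simp only: bracket_basis Dr(3) DL DI bracket_bilinear)

  have a: "a n = 0" for n
  proof (rule almost_additive_eq_0)
    show "a 0 = 0"
      using arg_cong[OF DL[of 0], of "L_coeff 0"] by (simp add: D0 coeff_linear coeff_zero)
    show "a 1 = 0"
      using arg_cong[OF DL[of 1], of "L_coeff 1"] by (simp only: D1 coeff_linear coeff_basis) simp
    show "a (n + m) = a n + a m" if "n \<noteq> m" for n m
    proof -
      have "of_int (m - n) * a (n + m) = of_int (m - n) * (a n + a m)"
        using arg_cong[OF LL, of "L_coeff (n + m)" m n] by (simp only: coeff_linear coeff_basis) (simp add: algebra_simps)
      with that show ?thesis
        unfolding mult_cancel_left of_int_eq_0_iff by simp
    qed
  qed
  have "of_int (m - n) * b (n + m) = of_int m * b m - of_int n * b n" if "n + m \<noteq> 0" for n m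
    using arg_cong[OF LL, of "I_coeff (n + m)" m n] that
    by (simp only: coeff_linear coeff_basis add.commute[of m n]) (simp add: mult.commute)
  then obtain A B where b: "\<And>n. n \<noteq> 0 \<Longrightarrow> b n = A + B * of_int n"
    using crossed_coeffs_affine[of b] by metis
  have "e 0 = 0"
    using arg_cong[OF DI[of 0], of "L_coeff 0"] by (simp add: Dr(4) coeff_linear coeff_zero)
  then have e: "e m = 0" if "m \<noteq> 0" for m
    using arg_cong[OF LI, of "L_coeff 0" m "- m"] that
    by (simp add: coeff_linear coeff_zero)
  have g: "g m = g 1" if "m \<noteq> 0" for m
    using arg_cong[OF LI, of "I_coeff m" 1 "m - 1"] that
    by (simp add: coeff_linear a)

  have "D = delta_comb B (A - B) (g 1)"
  proof (rule Der_eqI[OF D delta_comb_Der])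
    fix n :: int
    show "D (wL n) = delta_comb B (A - B) (g 1) (wL n)"
      by (cases "n = 0") (simp_all add: DL a b delta_comb_basis algebra_simps)
    show "D (wI n) = delta_comb B (A - B) (g 1) (wI n)" if "n \<noteq> 0"
      using e[OF that] g[OF that] by (simp add: DI delta_comb_basis)
  qed
  then show ?thesis by blast
qed

lemma ad_Der: "wbracket x \<in> wt.Der"
  using wt.Inn_subset_Der by (auto simp: wt.Inn_def)

text \<open>
  Two inner derivations are subtracted. The first one, \<open>ad x\<close> with \<open>x = - deg_inv (D L\<^sub>0)\<close>, reduces
  \<open>D L\<^sub>0\<close> to a multiple of \<open>L\<^sub>0\<close>, and this multiple is \<open>0\<close>, as the coefficients of \<open>L\<^sub>1\<close> in the identity
  \<open>D L\<^sub>1 = [D L\<^sub>0, L\<^sub>1] + [L\<^sub>0, D L\<^sub>1]\<close> show. The second one is a multiple of \<open>ad L\<^sub>0\<close>; it keeps \<open>D L\<^sub>0 = 0\<close> and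
  removes the component of \<open>D L\<^sub>1\<close> along \<open>L\<^sub>1\<close>.
\<close>

lemma Der_classify:
  assumes D: "D \<in> wt.Der"
  shows "\<exists>u\<in>wt.Inn. \<exists>c\<^sub>1 c\<^sub>2 c\<^sub>3. D = u + delta_comb c\<^sub>1 c\<^sub>2 c\<^sub>3"
proof -
  define x where "x = - deg_inv (D (wL 0))"
  define D' where "D' = D - wbracket x"
  have D': "D' \<in> wt.Der"
    unfolding D'_def by (intro wt.endo.subspace_diff subspace_Der D ad_Der)
  have "wbracket x (wL 0) = wbracket (wL 0) (deg_inv (D (wL 0)))"
    by (simp only: x_def wt.bracket_uminus_left wt.bracket_antisym[of "wL 0"])
  then have D'0: "D' (wL 0) = wscale (L_coeff 0 (D (wL 0))) (wL 0)"
    by (simp add: D'_def ad_L0_deg_inv)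
  moreover have "L_coeff 0 (D (wL 0)) = 0"
  proof -
    have "D' (wL 1) = wbracket (D' (wL 0)) (wL 1) + wbracket (wL 0) (D' (wL 1))"
      using Der_rules(1)[OF D', of "wL 0" "wL 1"] by (simp add: bracket_LL)
    then have "L_coeff 1 (D' (wL 1)) = L_coeff 1 (wbracket (D' (wL 0)) (wL 1) + wbracket (wL 0) (D' (wL 1)))"
      by (rule arg_cong)
    also have "\<dots> = L_coeff 0 (D (wL 0)) + L_coeff 1 (D' (wL 1))"
      by (simp add: coeff_linear L_coeff_ad_L0 D'0 bracket_bilinear bracket_LL)
    finally have "L_coeff 1 (D' (wL 1)) - L_coeff 1 (D' (wL 1)) = L_coeff 0 (D (wL 0))"
      by (simp only: diff_eq_eq)
    then show ?thesis
      by simp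
  qed
  ultimately have D'0: "D' (wL 0) = 0"
    by simp
  obtain p q where pq: "D' (wL 1) = wscale p (wL 1) + wscale q (wI 1)"
    using Der_homogeneous[OF D' D'0, of "wL 1" 1] by (auto simp: bracket_LL)
  define D'' where "D'' = D' - wbracket (wscale p (wL 0))"
  have D'': "D'' \<in> wt.Der"
    unfolding D''_def by (intro wt.endo.subspace_diff subspace_Der D' ad_Der)
  have "D'' (wL 0) = 0" "D'' (wL 1) = wscale q (wI 1)"
    by (simp_all add: D''_def D'0 pq bracket_bilinear bracket_LL)
  from Der_classify_normalized[OF D'' this] obtain c\<^sub>1 c\<^sub>2 c\<^sub>3 where c: "D'' = delta_comb c\<^sub>1 c\<^sub>2 c\<^sub>3"
    by blast
  have "D = wbracket (x + wscale p (wL 0)) + delta_comb c\<^sub>1 c\<^sub>2 c\<^sub>3"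
    by (simp add: fun_eq_iff wt.bracket_add_left D'_def D''_def flip: c)
  moreover have "wbracket (x + wscale p (wL 0)) \<in> wt.Inn"
    by (simp add: wt.Inn_def)
  ultimately show ?thesis by blast
qed

text \<open>
  \<open>\<delta>\<^sub>1\<close>, \<open>\<delta>\<^sub>2\<close> and \<open>d\<^sub>A\<^sub>b\<close> kill \<open>L\<^sub>0\<close>, so \<open>x\<close> commutes with \<open>L\<^sub>0\<close> whenever \<open>ad x\<close> is a combination of them;
  hence \<open>x\<close> is a multiple of \<open>L\<^sub>0\<close>, and \<open>L\<^sub>1\<close>, \<open>L\<^sub>-\<^sub>1\<close> and \<open>I\<^sub>1\<close> separate the coefficients.
\<close>

lemma delta_independent:
  assumes u: "u \<in> wt.Inn" and 0: "u + delta_comb c\<^sub>1 c\<^sub>2 c\<^sub>3 = 0"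
  shows "u = 0 \<and> c\<^sub>1 = 0 \<and> c\<^sub>2 = 0 \<and> c\<^sub>3 = 0"
proof -
  obtain x where x: "u = wbracket x"
    using u unfolding wt.Inn_def by blast
  have eq: "wbracket x y + delta_comb c\<^sub>1 c\<^sub>2 c\<^sub>3 y = 0" for y
    using fun_cong[OF 0, of y] by (simp add: x)
  have "wbracket x (wL 0) = 0"
    using eq[of "wL 0"] by (simp add: delta_comb_basis)
  then have "wbracket (wL 0) x = wscale (of_int 0) x"
    using wt.bracket_antisym[of "wL 0" x] by simp
  from L0_homogeneous[OF this] obtain p where p: "x = wscale p (wL 0)"
    by auto
  have 1: "wscale p (wL 1) + wscale (c\<^sub>1 * 2 + c\<^sub>2) (wI 1) = 0"
    using eq[of "wL 1"] by (simp add: p delta_comb_basis bracket_bilinear bracket_LL)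
  have p0: "p = 0"
    using arg_cong[OF 1, of "L_coeff 1"] by (simp add: coeff_linear coeff_zero)
  have "c\<^sub>1 * 2 + c\<^sub>2 = 0"
    using arg_cong[OF 1, of "I_coeff 1"] by (simp add: coeff_linear coeff_zero)
  have zero: "wbracket 0 y = 0" for y
    using wt.bracket_scale_left[of 0 0 y] by simp
  have "wscale c\<^sub>2 (wI (- 1)) = 0"
    using eq[of "wL (- 1)"] by (simp add: p p0 zero delta_comb_basis)
  from arg_cong[OF this, of "I_coeff (- 1)"] have "c\<^sub>2 = 0"
    by (simp add: coeff_linear coeff_zero)
  with \<open>c\<^sub>1 * 2 + c\<^sub>2 = 0\<close> have "c\<^sub>1 = 0"
    by simp
  have "wscale c\<^sub>3 (wI 1) = 0"
    using eq[of "wI 1"] by (simp add: p p0 zero delta_comb_basis)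
  from arg_cong[OF this, of "I_coeff 1"] have "c\<^sub>3 = 0"
    by (simp add: coeff_linear coeff_zero)
  moreover have "u = 0"
    by (simp add: x p p0 zero fun_eq_iff)
  ultimately show ?thesis
    using \<open>c\<^sub>1 = 0\<close> \<open>c\<^sub>2 = 0\<close> by simp
qed

section \<open>Passage to cohomology\<close>

lemma ZL2_eq_Z2: "wt.ZL2 = wt.Z2"
  using ZL2_subset_Z2 wt.Z2_subset_ZL2 by blast

lemma quot_rel_refl_Z2: "quot_rel wt.Z2 wt.B2 a a \<longleftrightarrow> a \<in> wt.Z2"
  by (simp add: quot_rel_def form.subspace_0 wt.subspace_B2)

lemma quot_rel_refl_ZL2: "quot_rel wt.ZL2 wt.BL2 a a \<longleftrightarrow> a \<in> wt.Z2"
  by (simp add: quot_rel_def form.subspace_0 wt.subspace_BL2 ZL2_eq_Z2)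

lemma H2_cases: obtains a where "a \<in> wt.Z2" "h = H2_class a"
  by (induction h rule: H2.abs_induct) (auto simp: quot_rel_refl_Z2)

lemma HL2_cases: obtains a where "a \<in> wt.Z2" "h = HL2_class a"
  by (induction h rule: HL2.abs_induct) (auto simp: quot_rel_refl_ZL2)

lemma H2_class_eq_0_iff: "a \<in> wt.Z2 \<Longrightarrow> H2_class a = 0 \<longleftrightarrow> a \<in> wt.B2"
  unfolding zero_H2.abs_eq
  using Quotient3_rel[OF Quotient3_H2, of a 0] form.subspace_0[OF wt.subspace_Z2]
  by (simp add: quot_rel_refl_Z2) (simp add: quot_rel_def)

lemma HL2_class_eq_0_iff: "a \<in> wt.Z2 \<Longrightarrow> HL2_class a = 0 \<longleftrightarrow> a \<in> wt.B2"
  unfolding zero_HL2.abs_eq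
  using Quotient3_rel[OF Quotient3_HL2, of a 0] form.subspace_0[OF wt.subspace_Z2]
  by (simp add: quot_rel_refl_ZL2) (simp add: quot_rel_def ZL2_eq_Z2 wt.B2_eq_BL2)

lemma H2_class_add: "a \<in> wt.Z2 \<Longrightarrow> b \<in> wt.Z2 \<Longrightarrow> H2_class (a + b) = H2_class a + H2_class b"
  by (simp add: plus_H2.abs_eq quot_rel_refl_Z2)

lemma H2_class_scale: "a \<in> wt.Z2 \<Longrightarrow> H2_class (form_scale c a) = H2_scale c (H2_class a)"
  by (simp add: H2_scale.abs_eq quot_rel_refl_Z2)

lemma H2_to_HL2_class: "a \<in> wt.Z2 \<Longrightarrow> H2_to_HL2 (H2_class a) = HL2_class a"
  by (simp add: H2_to_HL2.abs_eq quot_rel_refl_Z2)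

lemma linear_H2_to_HL2: "Vector_Spaces.linear H2_scale HL2_scale H2_to_HL2"
  unfolding Vector_Spaces.linear_iff
proof (intro conjI allI)
  show "vector_space H2_scale" "vector_space HL2_scale" by unfold_locales
  fix g h c
  obtain a b where ab: "a \<in> wt.Z2" "g = H2_class a" "b \<in> wt.Z2" "h = H2_class b"
    by (metis H2_cases)
  have sum: "a + b \<in> wt.Z2" and scale: "form_scale c a \<in> wt.Z2"
    using ab by (auto intro: form.subspace_add form.subspace_scale wt.subspace_Z2)
  have "H2_to_HL2 (g + h) = HL2_class (a + b)"
    by (simp only: ab sum H2_to_HL2_class flip: H2_class_add)
  also have "\<dots> = HL2_class a + HL2_class b"
    using ab by (simp add: plus_HL2.abs_eq quot_rel_refl_ZL2)
  finally show "H2_to_HL2 (g + h) = H2_to_HL2 g + H2_to_HL2 h"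
    using ab by (simp add: H2_to_HL2_class)
  have "H2_to_HL2 (H2_scale c g) = HL2_class (form_scale c a)"
    by (simp only: ab scale H2_to_HL2_class flip: H2_class_scale)
  also have "\<dots> = HL2_scale c (HL2_class a)"
    using ab by (simp add: HL2_scale.abs_eq quot_rel_refl_ZL2)
  finally show "H2_to_HL2 (H2_scale c g) = HL2_scale c (H2_to_HL2 g)"
    using ab by (simp add: H2_to_HL2_class)
qed

lemma bij_H2_to_HL2: "bij H2_to_HL2"
proof (rule bijI)
  show "inj H2_to_HL2"
  proof (rule injI)
    fix g h assume eq: "H2_to_HL2 g = H2_to_HL2 h"
    obtain a where a: "a \<in> wt.Z2" "g - h = H2_class a"
      by (rule H2_cases)
    have "H2_to_HL2 ((g - h) + h) = H2_to_HL2 (g - h) + H2_to_HL2 h"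
      by (rule linear_addD[OF linear_H2_to_HL2])
    with eq have "H2_to_HL2 (g - h) = 0"
      by simp
    with a have "g - h = 0"
      by (simp add: H2_to_HL2_class HL2_class_eq_0_iff H2_class_eq_0_iff)
    then show "g = h" by simp
  qed
  show "surj H2_to_HL2"
  proof (rule surjI)
    fix h
    obtain a where "a \<in> wt.Z2" "h = HL2_class a"
      by (rule HL2_cases)
    then show "H2_to_HL2 (H2_class (SOME a. a \<in> wt.Z2 \<and> h = HL2_class a)) = h"
      using someI[of "\<lambda>a. a \<in> wt.Z2 \<and> h = HL2_class a" a] by (simp add: H2_to_HL2_class)
  qed
qed

lemma H2_class_Omega_comb:
  "H2_class (Omega_comb c\<^sub>1 c\<^sub>2 c\<^sub>3 c\<^sub>4) = H2_scale c\<^sub>1 (H2_class Omega_Vir) + H2_scale c\<^sub>2 (H2_class Omega_1)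
    + H2_scale c\<^sub>3 (H2_class Omega_2) + H2_scale c\<^sub>4 (H2_class Omega_Ab)"
  unfolding Omega_comb_def
  by (simp add: H2_class_add H2_class_scale form.subspace_add form.subspace_scale wt.subspace_Z2
      Omega_Vir_cocycle Omega_1_cocycle Omega_2_cocycle Omega_Ab_cocycle)

lemma H2_direct_sum:
  "H2.direct_sum UNIV
    [H2.span {H2_class Omega_Vir}, H2.span {H2_class Omega_1},
     H2.span {H2_class Omega_2}, H2.span {H2_class Omega_Ab}]"
proof (rule H2.direct_sum_subspace_lines3)
  show "H2.subspace (H2.span {H2_class Omega_Vir})"
    by (rule H2.subspace_span)
  show "UNIV = {y + H2_scale a (H2_class Omega_1) + H2_scale b (H2_class Omega_2) + H2_scale c (H2_class Omega_Ab)
      | y a b c. y \<in> H2.span {H2_class Omega_Vir}}"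
  proof (intro equalityI subsetI CollectI)
    fix h :: H2
    obtain a where a: "a \<in> wt.Z2" "h = H2_class a"
      by (rule H2_cases)
    obtain b c\<^sub>1 c\<^sub>2 c\<^sub>3 c\<^sub>4 where b: "b \<in> wt.B2" "a = b + Omega_comb c\<^sub>1 c\<^sub>2 c\<^sub>3 c\<^sub>4"
      using Z2_classify[OF a(1)] by blast
    have "b = a - Omega_comb c\<^sub>1 c\<^sub>2 c\<^sub>3 c\<^sub>4"
      using b(2) by simp
    then have "b \<in> wt.Z2"
      using a(1) Omega_comb_Z2 by (simp add: form.subspace_diff wt.subspace_Z2)
    then have "h = H2_class (Omega_comb c\<^sub>1 c\<^sub>2 c\<^sub>3 c\<^sub>4)"
      using b H2_class_eq_0_iff[of b] by (simp add: a(2) H2_class_add Omega_comb_Z2)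
    then show "\<exists>y a b c. h = y + H2_scale a (H2_class Omega_1) + H2_scale b (H2_class Omega_2)
        + H2_scale c (H2_class Omega_Ab) \<and> y \<in> H2.span {H2_class Omega_Vir}"
      unfolding H2_class_Omega_comb H2.span_singleton by blast
  qed simp
next
  fix y a b c
  assume "y \<in> H2.span {H2_class Omega_Vir}" and 0: "y + H2_scale a (H2_class Omega_1) + H2_scale b (H2_class Omega_2)
      + H2_scale c (H2_class Omega_Ab) = 0"
  then obtain d where "y = H2_scale d (H2_class Omega_Vir)"
    unfolding H2.span_singleton by blast
  moreover from this 0 have "Omega_comb d a b c \<in> wt.B2"
    using H2_class_eq_0_iff[OF Omega_comb_Z2] by (simp only: H2_class_Omega_comb)
  then have "d = 0 \<and> a = 0 \<and> b = 0 \<and> c = 0"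
    by (rule Omega_independent)
  ultimately show "y = 0 \<and> a = 0 \<and> b = 0 \<and> c = 0"
    by simp
qed

lemma H2_class_Omega_nonzero:
  "0 \<notin> set [H2_class Omega_Vir, H2_class Omega_1, H2_class Omega_2, H2_class Omega_Ab]"
proof -
  have "Omega_Vir = Omega_comb 1 0 0 0" "Omega_1 = Omega_comb 0 1 0 0" "Omega_2 = Omega_comb 0 0 1 0"
    "Omega_Ab = Omega_comb 0 0 0 1"
    by (simp_all add: Omega_comb_def)
  then show ?thesis
    using Omega_independent[of 1 0 0 0] Omega_independent[of 0 1 0 0] Omega_independent[of 0 0 1 0]
      Omega_independent[of 0 0 0 1]
    by (auto simp: H2_class_eq_0_iff Omega_Vir_cocycle Omega_1_cocycle Omega_2_cocycle Omega_Ab_cocycle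
        dest!: sym[of 0])
qed

lemma dim_H2: "H2.dim UNIV = 4"
  using H2.dim_eq_length[OF _ H2_class_Omega_nonzero] H2_direct_sum by simp

lemma Der_direct_sum:
  "wt.endo.direct_sum wt.Der
    [wt.Inn, wt.endo.span {delta1}, wt.endo.span {delta2}, wt.endo.span {d_Ab}]"
proof (rule wt.endo.direct_sum_subspace_lines3)
  show "wt.endo.subspace wt.Inn"
    by (rule subspace_Inn)
  have comb: "y + fun_scale wscale a delta1 + fun_scale wscale b delta2 + fun_scale wscale c d_Ab
      = y + delta_comb a b c" for y a b c
    by (simp add: delta_comb_def add.assoc)
  show "wt.Der = {y + fun_scale wscale a delta1 + fun_scale wscale b delta2 + fun_scale wscale c d_Ab
      | y a b c. y \<in> wt.Inn}"
    unfolding comb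
  proof (intro equalityI subsetI)
    fix D assume "D \<in> wt.Der"
    from Der_classify[OF this] show "D \<in> {y + delta_comb a b c | y a b c. y \<in> wt.Inn}"
      by blast
  next
    fix D assume "D \<in> {y + delta_comb a b c | y a b c. y \<in> wt.Inn}"
    then obtain y a b c where "D = y + delta_comb a b c" "y \<in> wt.Inn"
      by blast
    then show "D \<in> wt.Der"
      using wt.Inn_subset_Der delta_comb_Der by (auto intro: wt.endo.subspace_add subspace_Der)
  qed
  show "y = 0 \<and> a = 0 \<and> b = 0 \<and> c = 0"
    if "y \<in> wt.Inn" "y + fun_scale wscale a delta1 + fun_scale wscale b delta2 + fun_scale wscale c d_Ab = 0"
    for y a b c
    using that unfolding comb by (rule delta_independent)
qed

lemma quot_rel_refl_Der: "quot_rel wt.Z1_ad wt.B1_ad D D \<longleftrightarrow> D \<in> wt.Der"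
  by (simp add: quot_rel_def wt.endo.subspace_0 wt.subspace_B1_ad wt.Der_eq_Z1_ad)

lemma H1ad_cases: obtains D where "D \<in> wt.Der" "h = H1ad_class D"
  by (induction h rule: H1ad.abs_induct) (auto simp: quot_rel_refl_Der)

lemma H1ad_class_eq_0_iff: "D \<in> wt.Der \<Longrightarrow> H1ad_class D = 0 \<longleftrightarrow> D \<in> wt.Inn"
  unfolding zero_H1ad.abs_eq
  using Quotient3_rel[OF Quotient3_H1ad, of D 0] wt.endo.subspace_0[OF subspace_Der]
  by (simp add: quot_rel_refl_Der) (simp add: quot_rel_def wt.Inn_eq_B1_ad wt.Der_eq_Z1_ad)

lemma H1ad_class_add: "D \<in> wt.Der \<Longrightarrow> D' \<in> wt.Der \<Longrightarrow> H1ad_class (D + D') = H1ad_class D + H1ad_class D'"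
  by (simp add: plus_H1ad.abs_eq quot_rel_refl_Der)

lemma H1ad_class_scale: "D \<in> wt.Der \<Longrightarrow> H1ad_class (fun_scale wscale c D) = H1ad_scale c (H1ad_class D)"
  by (simp add: H1ad_scale.abs_eq quot_rel_refl_Der)

lemma H1ad_class_delta_comb:
  "H1ad_class (delta_comb c\<^sub>1 c\<^sub>2 c\<^sub>3) = H1ad_scale c\<^sub>1 (H1ad_class delta1) + H1ad_scale c\<^sub>2 (H1ad_class delta2)
    + H1ad_scale c\<^sub>3 (H1ad_class d_Ab)"
  unfolding delta_comb_def
  by (simp add: H1ad_class_add H1ad_class_scale wt.endo.subspace_add wt.endo.subspace_scale subspace_Der
      delta1_Der delta2_Der d_Ab_Der)

lemma delta_comb_Inn: "delta_comb c\<^sub>1 c\<^sub>2 c\<^sub>3 \<in> wt.Inn \<Longrightarrow> c\<^sub>1 = 0 \<and> c\<^sub>2 = 0 \<and> c\<^sub>3 = 0"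
proof -
  assume "delta_comb c\<^sub>1 c\<^sub>2 c\<^sub>3 \<in> wt.Inn"
  then have "- delta_comb c\<^sub>1 c\<^sub>2 c\<^sub>3 \<in> wt.Inn"
    by (rule wt.endo.subspace_neg[OF subspace_Inn])
  from delta_independent[OF this left_minus] show ?thesis by blast
qed

lemma H1ad_direct_sum:
  "H1ad.direct_sum UNIV
    [H1ad.span {H1ad_class delta1}, H1ad.span {H1ad_class delta2}, H1ad.span {H1ad_class d_Ab}]"
proof (rule H1ad.direct_sum_lines3)
  show "UNIV = {H1ad_scale a (H1ad_class delta1) + H1ad_scale b (H1ad_class delta2) + H1ad_scale c (H1ad_class d_Ab)
      | a b c. True}"
  proof (intro equalityI subsetI CollectI)
    fix h :: H1ad
    obtain D where D: "D \<in> wt.Der" "h = H1ad_class D"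
      by (rule H1ad_cases)
    obtain u c\<^sub>1 c\<^sub>2 c\<^sub>3 where u: "u \<in> wt.Inn" "D = u + delta_comb c\<^sub>1 c\<^sub>2 c\<^sub>3"
      using Der_classify[OF D(1)] by blast
    then have "u \<in> wt.Der"
      using wt.Inn_subset_Der by blast
    then have "h = H1ad_class (delta_comb c\<^sub>1 c\<^sub>2 c\<^sub>3)"
      using u H1ad_class_eq_0_iff[of u] by (simp add: D(2) H1ad_class_add delta_comb_Der)
    then show "\<exists>a b c. h = H1ad_scale a (H1ad_class delta1) + H1ad_scale b (H1ad_class delta2)
        + H1ad_scale c (H1ad_class d_Ab) \<and> True"
      unfolding H1ad_class_delta_comb by blast
  qed simp
  show "a = 0 \<and> b = 0 \<and> c = 0" if "H1ad_scale a (H1ad_class delta1) + H1ad_scale b (H1ad_class delta2)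
      + H1ad_scale c (H1ad_class d_Ab) = 0" for a b c
    using that H1ad_class_eq_0_iff[OF delta_comb_Der] by (intro delta_comb_Inn) (simp only: H1ad_class_delta_comb)
qed

lemma H1ad_class_nonzero: "0 \<notin> set [H1ad_class delta1, H1ad_class delta2, H1ad_class d_Ab]"
proof -
  have "delta1 = delta_comb 1 0 0" "delta2 = delta_comb 0 1 0" "d_Ab = delta_comb 0 0 1"
    by (simp_all add: delta_comb_def)
  then show ?thesis
    using delta_comb_Inn[of 1 0 0] delta_comb_Inn[of 0 1 0] delta_comb_Inn[of 0 0 1]
    by (auto simp: H1ad_class_eq_0_iff delta1_Der delta2_Der d_Ab_Der dest!: sym[of 0])
qed

lemma dim_H1ad: "H1ad.dim UNIV = 3"
  using H1ad.dim_eq_length[OF _ H1ad_class_nonzero] H1ad_direct_sum by simp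

theorem theorem1p5:
  shows "Vector_Spaces.linear H2_scale HL2_scale H2_to_HL2 \<and> bij H2_to_HL2 \<and>
    {Omega_Vir, Omega_1, Omega_2, Omega_Ab} \<subseteq> wt.Z2 \<and>
    H2.direct_sum UNIV
      [H2.span {H2_class Omega_Vir}, H2.span {H2_class Omega_1},
       H2.span {H2_class Omega_2}, H2.span {H2_class Omega_Ab}] \<and>
    wt.endo.direct_sum wt.Der
      [wt.Inn, wt.endo.span {delta1}, wt.endo.span {delta2}, wt.endo.span {d_Ab}] \<and>
    H2.dim UNIV = 4 \<and>
    H1ad.dim UNIV = 3"
  using linear_H2_to_HL2 bij_H2_to_HL2 Omega_Vir_cocycle Omega_1_cocycle Omega_2_cocycle Omega_Ab_cocycle
    H2_direct_sum Der_direct_sum dim_H2 dim_H1ad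
  by blast

end
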